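(* Let $G$ and $H$ be finite groups, let $V$ be the regular representation of $G$ over $\mathbb C$ and $V'$ the regular representation of $H$ over $\mathbb C$. Assume that one of the following holds: (1) $G=D_{2p}$ is the dihedral group of order $2p$, where $p\ge 5$ is a prime; (2) $|H|\ge |G|^2$, and there do not exist two divisors $d_1,d_2>1$ of $|G|$ with $d_1-d_2=1$. Then $\dim \mathbb C[V]^G_{|H|}=\dim \mathbb C[V']^H_{|G|}$ if and only if $\varphi_G(d)=\varphi_H(d)$ for every positive integer $d$ dividing $\gcd(|G|,|H|)$.
   Context: For a finite group $G$ and a finite-dimensional complex representation $V$ of $G$, $\mathbb C[V]$ is the graded algebra of polynomial functions on $V$ (the symmetric algebra on $V^*$), with the action of $G$ induced by $f^g(v)=f(g\cdot v)$; $\mathbb C[V]^G$ is the subalgebra of $G$-invariant polynomials and $\mathbb C[V]^G_m$ its homogeneous component of degree $m$. $\varphi_G(d)$ denotes the number of elements of $G$ of order exactly $d$. The dihedral group of order $2p$ is $D_{2p}=\langle x,y \mid x^2=1=y^p,\ xyx=y^{-1}\rangle$. *)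

theory Defs
  imports
    "HOL-Algebra.Multiplicative_Group"
    "HOL-Library.Function_Algebras"
    "HOL-Computational_Algebra.Primes"
begin

section \<open>Complex-valued functions on a set\<close>

definition cscale :: "complex \<Rightarrow> ('a \<Rightarrow> complex) \<Rightarrow> 'a \<Rightarrow> complex" where
  "cscale c f = (\<lambda>x. c * f x)"

interpretation cfun: vector_space "cscale :: complex \<Rightarrow> ('a \<Rightarrow> complex) \<Rightarrow> 'a \<Rightarrow> complex"
  by unfold_locales (auto simp: cscale_def fun_eq_iff algebra_simps)

text \<open>A function on a set \<open>S\<close> is represented by its extension by zero to the whole type.
  This is used both for vectors (functions on a group) and for polynomial functions
  (functions on a space of vectors), so that equality and linear independence only depend
  on the values on \<open>S\<close>.\<close>

definition cfuns_on :: "'a set \<Rightarrow> ('a \<Rightarrow> complex) set" where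
  "cfuns_on S = {f. \<forall>x. x \<notin> S \<longrightarrow> f x = 0}"


section \<open>Polynomial functions and invariants\<close>

definition dual_space :: "('a \<Rightarrow> complex) set \<Rightarrow> (('a \<Rightarrow> complex) \<Rightarrow> complex) set" where
  "dual_space V = {l \<in> cfuns_on V.
     (\<forall>u\<in>V. \<forall>v\<in>V. l (u + v) = l u + l v) \<and> (\<forall>c. \<forall>v\<in>V. l (cscale c v) = c * l v)}"

text \<open>The image of the \<open>m\<close>-th symmetric power of the dual space: linear combinations of
  products of \<open>m\<close> linear forms.\<close>

definition poly_funs_deg ::
    "('a \<Rightarrow> complex) set \<Rightarrow> nat \<Rightarrow> (('a \<Rightarrow> complex) \<Rightarrow> complex) set" where
  "poly_funs_deg V m =
     cfun.span {(\<lambda>v. if v \<in> V then (\<Prod>i<m. l i v) else 0) | l. \<forall>i<m. l i \<in> dual_space V}"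

definition poly_funs :: "('a \<Rightarrow> complex) set \<Rightarrow> (('a \<Rightarrow> complex) \<Rightarrow> complex) set" where
  "poly_funs V = cfun.span (\<Union>m. poly_funs_deg V m)"

definition invariant_poly_funs ::
    "('g, 'z) monoid_scheme \<Rightarrow> ('a \<Rightarrow> complex) set \<Rightarrow> ('g \<Rightarrow> ('a \<Rightarrow> complex) \<Rightarrow> 'a \<Rightarrow> complex)
      \<Rightarrow> (('a \<Rightarrow> complex) \<Rightarrow> complex) set" where
  "invariant_poly_funs G V \<rho> = {f \<in> poly_funs V. \<forall>g\<in>carrier G. \<forall>v\<in>V. f (\<rho> g v) = f v}"

definition invariant_poly_funs_deg ::
    "('g, 'z) monoid_scheme \<Rightarrow> ('a \<Rightarrow> complex) set \<Rightarrow> ('g \<Rightarrow> ('a \<Rightarrow> complex) \<Rightarrow> 'a \<Rightarrow> complex)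
      \<Rightarrow> nat \<Rightarrow> (('a \<Rightarrow> complex) \<Rightarrow> complex) set" where
  "invariant_poly_funs_deg G V \<rho> m = invariant_poly_funs G V \<rho> \<inter> poly_funs_deg V m"


section \<open>The regular representation\<close>

definition regular_space :: "('g, 'z) monoid_scheme \<Rightarrow> ('g \<Rightarrow> complex) set" where
  "regular_space G = cfuns_on (carrier G)"

text \<open>The function \<open>v\<close> stands for the sum of the \<open>v x\<close>-multiples of the basis vectors
  \<open>e x\<close>, \<open>x \<in> carrier G\<close>; the inverse arises because \<open>g\<close> sends \<open>e x\<close> to \<open>e (g x)\<close>.\<close>

definition regular_rep ::
    "('g, 'z) monoid_scheme \<Rightarrow> 'g \<Rightarrow> ('g \<Rightarrow> complex) \<Rightarrow> 'g \<Rightarrow> complex" where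
  "regular_rep G g v = (\<lambda>x. if x \<in> carrier G then v (inv\<^bsub>G\<^esub> g \<otimes>\<^bsub>G\<^esub> x) else 0)"

lemma (in group) regular_rep_basis:
  assumes "g \<in> carrier G" "h \<in> carrier G"
  shows "regular_rep G g (\<lambda>x. if x = h then 1 else 0) = (\<lambda>x. if x = g \<otimes> h then 1 else 0)"
  using assms by (auto simp: regular_rep_def fun_eq_iff inv_solve_left' m_assoc[symmetric])


section \<open>Groups\<close>

definition num_elems_ord :: "('g, 'z) monoid_scheme \<Rightarrow> nat \<Rightarrow> nat" where
  "num_elems_ord G d = card {g \<in> carrier G. group.ord G g = d}"

text \<open>\<open>G\<close> is dihedral of order \<open>2n\<close>, with presentation
  \<open>\<langle>x, y | x\<^sup>2 = 1 = y\<^sup>n, x y x = y\<^sup>-\<^sup>1\<rangle>\<close>. The generators and relations make \<open>G\<close> a quotient of the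
  presented group, and the condition on the order rules out proper quotients.\<close>

definition dihedral_group :: "nat \<Rightarrow> ('g, 'z) monoid_scheme \<Rightarrow> bool" where
  "dihedral_group n G \<longleftrightarrow> group G \<and> order G = 2 * n \<and>
     (\<exists>x\<in>carrier G. \<exists>y\<in>carrier G. generate G {x, y} = carrier G \<and>
        x [^]\<^bsub>G\<^esub> (2::nat) = \<one>\<^bsub>G\<^esub> \<and> y [^]\<^bsub>G\<^esub> n = \<one>\<^bsub>G\<^esub> \<and>
        x \<otimes>\<^bsub>G\<^esub> y \<otimes>\<^bsub>G\<^esub> x = inv\<^bsub>G\<^esub> y)"

end

theory Submission
  imports
    Defs
    "HOL-Number_Theory.Totient"
    "HOL-Algebra.Weak_Morphisms"
    "HOL-Algebra.Group_Action"
begin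

text \<open>Write \<open>n\<close> and \<open>m\<close> for the orders of \<open>G\<close> and \<open>H\<close>. The invariants of degree \<open>m\<close> have a basis
  indexed by the orbits of \<open>G\<close> on the monomials of degree \<open>m\<close>, and Burnside's lemma turns the
  dimension into the sum of \<open>\<phi>\<^sub>G(d) * ((n + m) / d choose n / d) / (n + m)\<close> over the common divisors
  \<open>d\<close> of \<open>n\<close> and \<open>m\<close>. The weights are symmetric in \<open>n\<close> and \<open>m\<close>, so the dimensions agree iff the
  weighted sums of \<open>\<phi>\<^sub>G\<close> and \<open>\<phi>\<^sub>H\<close> agree. If \<open>\<phi>\<^sub>G\<close> and \<open>\<phi>\<^sub>H\<close> differ, the term at the least \<open>d\<close> where
  they do dominates all later terms, because the weights decrease fast. The one exception for
  \<open>m \<ge> n\<^sup>2\<close> is a later \<open>d'\<close> with \<open>n / d - n / d' = 1\<close>; without consecutive divisors this forces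
  \<open>d = n / 2\<close>, and there Frobenius' theorem on the number of solutions of
  \<open>x\<^sup>d = 1\<close> shows that the difference is a multiple of \<open>d\<close>, which is large enough.
  In the dihedral case only \<open>d \<in> {2, p, 2 * p}\<close> occur, and the values at \<open>p\<close> and \<open>2 * p\<close> are least
  possible for \<open>G\<close>.\<close>

section \<open>Frobenius' theorem\<close>

text \<open>How fast the weights must fall depends on which group has the surplus at the least
  differing divisor \<open>d0\<close>. The elements of larger order number fewer than
  \<open>n\<close> in G, but in H only fewer than \<open>m\<close>. Each unit by which
  \<open>n div d\<close> lies below \<open>n div d0\<close> costs the weight a factor of at least
  \<open>m / n\<close>. If \<open>n^2 <= m\<close>, one unit yields a factor \<open>n\<close>, which
  suffices when H has the surplus and G has to catch up. When G has the surplus, a factor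
  \<open>m\<close> is wanted, and this takes two units. So a one-unit drop obstructs only a surplus
  of G; there a surplus of 1 would be too weak, and divisibility has to supply a larger one.
  Frobenius' theorem itself is an induction on the group order that passes to quotients. The
  induction cannot change the type of the elements, so the quotients are rebuilt on coset
  representatives, inside the type of the original group.\<close>

lemma (in group) totient_dvd_num_elems_ord:
  assumes fin: "finite (carrier G)"
  shows "totient d dvd num_elems_ord G d"
proof -
  define A where "A = {x \<in> carrier G. ord x = d}"
  have finA: "finite A"
    using fin by (simp add: A_def)
  \<comment> \<open>Elements of order \<open>d\<close> are sorted by the cyclic subgroup they
    generate. The generators of one such subgroup are the powers of \<open>x\<close> with exponent
    prime to \<open>d\<close>, so all classes have size \<open>totient d\<close>.\<close>
  have fibre: "card {y \<in> A. generate G {y} = generate G {x}} = totient d" if x: "x \<in> A" for x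
  proof -
    have xc: "x \<in> carrier G" and ordx: "ord x = d"
      using x by (auto simp: A_def)
    have d: "d > 0"
      using ord_ge_1[OF fin xc] ordx by simp
    have "{y \<in> A. generate G {y} = generate G {x}} = (\<lambda>k. x [^] k) ` totatives d" (is "?L = ?R")
    proof
      show "?L \<subseteq> ?R"
      proof
        fix y assume "y \<in> ?L"
        then have y: "y \<in> carrier G" "ord y = d" "generate G {y} = generate G {x}"
          by (auto simp: A_def)
        then have "y \<in> generate G {x}"
          using generate.incl[of y "{y}" G] by auto
        then obtain k :: nat where k: "y = x [^] k"
          using generate_pow_on_finite_carrier[OF fin xc] by auto
        have cop: "coprime k d"
          using pow_ord_eq_ord_iff[OF fin xc, of k] y k ordx by simp
        \<comment> \<open>\<open>totatives d\<close> lies in the range from 1 to \<open>d\<close>,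
          so the residue 0 is represented by \<open>d\<close>. As \<open>k\<close> is prime to
          \<open>d\<close>, this happens only for \<open>d = 1\<close>.\<close>
        define l where "l = (if k mod d = 0 then d else k mod d)"
        have lk: "[l = k] (mod d)"
          by (auto simp: l_def cong_def)
        then have "int d dvd int k - int l"
          by (metis cong_iff_dvd_diff cong_int_iff cong_sym)
        have "0 < l" "l \<le> d"
          using d by (auto simp: l_def less_imp_le)
        moreover have "x [^] l = y"
          using int_pow_eq[OF xc, of "int l" "int k"] ordx k
            \<open>int d dvd int k - int l\<close> by (simp add: int_pow_int)
        moreover have "coprime l d"
          using cop lk by (meson cong_imp_coprime cong_sym)
        ultimately show "y \<in> ?R"
          by (auto simp: totatives_def)
      qed
      show "?R \<subseteq> ?L"
      proof
        fix y assume "y \<in> ?R"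
        then obtain k where k: "k \<in> totatives d" "y = x [^] k"
          by auto
        have yc: "y \<in> carrier G"
          using k xc by simp
        have ordy: "ord y = d"
          using pow_ord_eq_ord_iff[OF fin xc, of k] k ordx by (auto simp: totatives_def)
        have "generate G {y} \<subseteq> generate G {x}"
          using k generate_pow_on_finite_carrier[OF fin xc] xc yc
            generate_subgroup_incl[OF _ generate_is_subgroup[of "{x}"], of "{y}"] by auto
        moreover have "card (generate G {y}) = card (generate G {x})"
          using generate_pow_card xc yc ordx ordy by metis
        moreover have "finite (generate G {x})"
          using fin generate_incl[of "{x}"] xc finite_subset by blast
        ultimately show "y \<in> ?L"
          using card_subset_eq yc ordy by (auto simp: A_def)
      qed
    qed
    moreover have "inj_on (\<lambda>k. x [^] k) (totatives d)"
      using ord_inj'[OF xc] by (rule inj_on_subset) (auto simp: totatives_def ordx)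
    ultimately show ?thesis
      by (simp add: card_image totient_def)
  qed
  have "card A = (\<Sum>C\<in>(\<lambda>x. generate G {x}) ` A. card {y \<in> A. generate G {y} = C})"
    using sum.image_gen[OF finA, of "\<lambda>_. 1::nat"] by simp
  also have "\<dots> = (\<Sum>C\<in>(\<lambda>x. generate G {x}) ` A. totient d)"
    by (rule sum.cong) (auto simp: fibre)
  finally show ?thesis
    by (simp add: num_elems_ord_def A_def)
qed

section \<open>Counting s-th roots of the identity in central quotients and centralizers\<close>

lemma (in group) ord_pos: "finite (carrier G) \<Longrightarrow> x \<in> carrier G \<Longrightarrow> ord x > 0"
  using ord_ge_1 by fastforce

lemma (in group) pow_dvd_eq_one: "x \<in> carrier G \<Longrightarrow> x [^] (a::nat) = \<one> \<Longrightarrow> a dvd b \<Longrightarrow> x [^] b = \<one>"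
  using pow_eq_id by (meson dvd_trans)

text \<open>Every coset of the subgroup generated by \<open>u\<close> whose s-th power is trivial
  contains exactly one s-th root of the identity. Two such roots differ by a power of
  \<open>u\<close> killed by \<open>s\<close>, which is trivial since \<open>ord u\<close> is prime
  to \<open>s\<close>; and for the same reason any representative can be corrected by a power of
  \<open>u\<close> to become a root.\<close>

lemma (in group) card_roots_central_quotient:
  fixes s :: nat
  assumes fin: "finite (carrier G)" and u: "u \<in> carrier G"
    and central: "\<And>g. g \<in> carrier G \<Longrightarrow> g \<otimes> u = u \<otimes> g"
    and cop: "coprime (ord u) s"
  obtains K :: "'a monoid" where "group K" "finite (carrier K)" "order K * ord u = order G"
    "card {v \<in> carrier K. v [^]\<^bsub>K\<^esub> s = \<one>\<^bsub>K\<^esub>} = card {v \<in> carrier G. v [^] s = \<one>}"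
proof -
  define U where "U = generate G {u}"
  have U: "U = {u [^] k | k::nat. True}"
    using generate_pow_on_finite_carrier[OF fin u] by (simp add: U_def)
  have subU: "subgroup U G"
    using generate_is_subgroup[of "{u}"] u by (simp add: U_def)
  have cpow: "g \<otimes> u [^] k = u [^] k \<otimes> g" if "g \<in> carrier G" for g and k :: nat
  proof (induction k)
    case (Suc k)
    have "g \<otimes> (u [^] k \<otimes> u) = u [^] k \<otimes> (g \<otimes> u)"
      using Suc that u by (simp flip: m_assoc)
    then show ?case
      using central[OF that] that u by (simp add: m_assoc)
  qed (use that in simp)
  have normU: "U \<lhd> G"
  proof (rule normal_invI[OF subU])
    fix x h assume x: "x \<in> carrier G" and "h \<in> U"
    then obtain k :: nat where h: "h = u [^] k"
      using U by auto
    have "x \<otimes> h \<otimes> inv x = h"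
      using x u h cpow[OF x, of k] by (simp add: m_assoc)
    then show "x \<otimes> h \<otimes> inv x \<in> U"
      using \<open>h \<in> U\<close> by simp
  qed
  \<comment> \<open>The chosen representative depends only on the coset, so
    \<open>image_group f G\<close> is a copy of the quotient whose elements again have type
    \<open>'a\<close>.\<close>
  define f where "f x = (SOME y. y \<in> U #> x)" for x
  have f_in: "f x \<in> U #> x" if "x \<in> carrier G" for x
    unfolding f_def using rcos_self[OF that subU] by (rule someI)
  have fwm: "weak_group_morphism f U G"
  proof (rule weak_group_morphismsI[OF normU])
    fix a b assume a: "a \<in> carrier G" and b: "b \<in> carrier G"
    have "f a = f b \<longleftrightarrow> U #> a = U #> b"
    proof
      assume "f a = f b"
      then have "f a \<in> U #> a" "f a \<in> U #> b"
        using f_in[OF a] f_in[OF b] by simp_all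
      then show "U #> a = U #> b"
        using a b subU by (metis repr_independence)
    qed (simp add: f_def)
    also have "\<dots> \<longleftrightarrow> a \<otimes> inv b \<in> U"
      using repr_independence[OF _ b subU, of a] repr_independenceD[OF subU a, of b]
        subgroup.rcos_module[OF subU is_group b a] by metis
    finally show "f a = f b \<longleftrightarrow> a \<otimes> inv b \<in> U" .
  qed
  define K where "K = image_group f G"
  interpret fh: group_hom G K f
    unfolding K_def by (rule weak_group_morphism_group_hom[OF fwm])
  have carK: "carrier K = f ` carrier G"
    by (simp add: K_def image_group_carrier)
  have "order K = order (G Mod U)"
    using iso_same_card[OF is_isoI[OF weak_group_morphism_is_iso[OF fwm]]]
    by (simp add: K_def order_def)
  then have ordK: "order K * card U = order G"
    using lagrange[OF subU] by (simp add: FactGroup_def order_def)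
  have cardU: "card U = ord u"
    using generate_pow_card[OF u] by (simp add: U_def)
  have ker: "f x = \<one>\<^bsub>K\<^esub> \<longleftrightarrow> x \<in> U" if "x \<in> carrier G" for x
    using weak_group_morphism_ker[OF fwm] that by (auto simp: K_def kernel_def)
  have "bij_betw f {v \<in> carrier G. v [^] s = \<one>} {v \<in> carrier K. v [^]\<^bsub>K\<^esub> s = \<one>\<^bsub>K\<^esub>}"
    unfolding bij_betw_def
  proof
    show "inj_on f {v \<in> carrier G. v [^] s = \<one>}"
    proof (rule inj_onI, clarsimp)
      fix v w assume v: "v \<in> carrier G" "v [^] s = \<one>" and w: "w \<in> carrier G" "w [^] s = \<one>"
        and eq: "f v = f w"
      have "v \<otimes> inv w \<in> U"
        using weak_group_morphism.inj_mod_subgroup[OF fwm] v w eq by simp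
      then obtain k :: nat where k: "v \<otimes> inv w = u [^] k"
        using U by auto
      then have vk: "v = u [^] k \<otimes> w"
        using inv_solve_right'[of "u [^] k" v w] v(1) w(1) u by simp
      have "(u [^] k) [^] s = \<one>"
        using pow_mult_distrib[of "u [^] k" w s] cpow[of w k] v w u vk by simp
      then have "ord u dvd k * s"
        using u by (simp add: nat_pow_pow pow_eq_id)
      then have "ord u dvd k"
        using cop by (simp add: coprime_dvd_mult_left_iff)
      then show "v = w"
        using vk u w by (simp add: pow_eq_id)
    qed
    show "f ` {v \<in> carrier G. v [^] s = \<one>} = {v \<in> carrier K. v [^]\<^bsub>K\<^esub> s = \<one>\<^bsub>K\<^esub>}"
    proof
      show "f ` {v \<in> carrier G. v [^] s = \<one>} \<subseteq> {v \<in> carrier K. v [^]\<^bsub>K\<^esub> s = \<one>\<^bsub>K\<^esub>}"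
        by (auto simp flip: fh.hom_nat_pow)
      show "{v \<in> carrier K. v [^]\<^bsub>K\<^esub> s = \<one>\<^bsub>K\<^esub>} \<subseteq> f ` {v \<in> carrier G. v [^] s = \<one>}"
      proof
        fix w assume "w \<in> {v \<in> carrier K. v [^]\<^bsub>K\<^esub> s = \<one>\<^bsub>K\<^esub>}"
        then obtain x where x: "x \<in> carrier G" "w = f x" "f (x [^] s) = \<one>\<^bsub>K\<^esub>"
          using carK by (auto simp: fh.hom_nat_pow)
        then have "x [^] s \<in> U"
          using ker by simp
        then obtain i :: nat where i: "x [^] s = u [^] i"
          using U by auto
        obtain t where t: "[s * t = 1] (mod ord u)"
          using cong_solve_coprime_nat[of s "ord u"] cop by (auto simp: coprime_commute)
        \<comment> \<open>The correcting exponent has to solve \<open>j * s + i = 0\<close> modulo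
          \<open>ord u\<close>, that is, \<open>j = - i * t\<close> with \<open>t\<close> inverse to
          \<open>s\<close>. The factor \<open>ord u - 1\<close> plays the role of -1 in the natural
          numbers.\<close>
        define j where "j = i * t * (ord u - 1)"
        have "[j * s + i = i * (ord u - 1) * (s * t) + i] (mod ord u)"
          by (simp add: j_def mult_ac)
        also have "[i * (ord u - 1) * (s * t) + i = i * (ord u - 1) * 1 + i] (mod ord u)"
          by (intro cong_add cong_mult cong_refl t)
        also have "i * (ord u - 1) * 1 + i = i * ord u"
          using ord_pos[OF fin u] by (cases "ord u") auto
        finally have "ord u dvd j * s + i"
          by (simp add: cong_def mod_eq_0_iff_dvd)
        then have "(u [^] j) [^] s \<otimes> u [^] i = \<one>"
          using u by (simp add: nat_pow_pow nat_pow_mult pow_eq_id)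
        moreover have "(u [^] j \<otimes> x) [^] s = (u [^] j) [^] s \<otimes> x [^] s"
          using u x cpow[of x j] by (intro pow_mult_distrib) auto
        ultimately have "(u [^] j \<otimes> x) [^] s = \<one>"
          using i by simp
        moreover have "f (u [^] j \<otimes> x) = w"
          using x u ker[of "u [^] j"] U by auto
        ultimately show "w \<in> f ` {v \<in> carrier G. v [^] s = \<one>}"
          using u x by (intro image_eqI[of _ _ "u [^] j \<otimes> x"]) auto
      qed
    qed
  qed
  then have "card {v \<in> carrier K. v [^]\<^bsub>K\<^esub> s = \<one>\<^bsub>K\<^esub>} = card {v \<in> carrier G. v [^] s = \<one>}"
    by (simp add: bij_betw_same_card)
  with that[of K] show ?thesis
    using fh.H.is_group fin carK ordK cardU by simp
qed

lemma (in group) roots_eq_roots_gcd_order: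
  fixes s :: nat
  assumes "finite (carrier G)"
  shows "{v \<in> carrier G. v [^] s = \<one>} = {v \<in> carrier G. v [^] gcd s (order G) = \<one>}"
  using ord_dvd_group_order by (auto simp: pow_eq_id)

definition (in group) centralizer :: "'a \<Rightarrow> 'a set" where
  "centralizer u = {g \<in> carrier G. g \<otimes> u = u \<otimes> g}"

lemma (in group) subgroup_centralizer:
  assumes u: "u \<in> carrier G"
  shows "subgroup (centralizer u) G"
proof (rule subgroupI)
  show "centralizer u \<subseteq> carrier G" "centralizer u \<noteq> {}"
    using u by (auto simp: centralizer_def)
next
  fix a assume "a \<in> centralizer u"
  then have a: "a \<in> carrier G" "a \<otimes> u = u \<otimes> a"
    by (auto simp: centralizer_def)
  then have "u = inv a \<otimes> (u \<otimes> a)"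
    using u by (metis inv_solve_left m_closed)
  then have "u \<otimes> inv a = inv a \<otimes> u"
    using a u by (metis inv_closed inv_solve_right' m_assoc m_closed)
  then show "inv a \<in> centralizer u"
    using a by (simp add: centralizer_def)
next
  fix a b assume "a \<in> centralizer u" "b \<in> centralizer u"
  then show "a \<otimes> b \<in> centralizer u"
    using u by (auto simp: centralizer_def) (metis m_assoc)
qed

lemma (in group) centralizer_eq_stabilizer:
  assumes "u \<in> carrier G"
  shows "centralizer u = stabilizer G (\<lambda>g. \<lambda>h\<in>carrier G. g \<otimes> h \<otimes> inv g) u"
  using assms by (auto simp: centralizer_def stabilizer_def inv_solve_right')

text \<open>\<open>u\<close> is central in its centralizer, so dividing by it gives a smaller group
  with equally many s-th roots of the identity. The induction hypothesis speaks of divisors of the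
  order only, so \<open>s\<close> is first replaced by its gcd with the order of the quotient, which
  leaves the set of roots unchanged. Since \<open>ord u\<close> is prime to \<open>s\<close>, that
  gcd is also the one with the order of the centralizer.\<close>

lemma (in group) gcd_dvd_card_centralizer_roots:
  fixes s :: nat
  assumes fin: "finite (carrier G)" and u: "u \<in> carrier G" and u1: "ord u > 1"
    and cop: "coprime (ord u) s"
    and IH: "\<And>(K :: 'a monoid) s. group K \<Longrightarrow> finite (carrier K) \<Longrightarrow> order K < order G \<Longrightarrow>
      s dvd order K \<Longrightarrow> s dvd card {x \<in> carrier K. x [^]\<^bsub>K\<^esub> s = \<one>\<^bsub>K\<^esub>}"
  shows "gcd s (card (centralizer u)) dvd card {v \<in> centralizer u. v [^] s = \<one>}"
proof -
  let ?C = "G\<lparr>carrier := centralizer u\<rparr>"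
  have sub: "subgroup (centralizer u) G"
    by (rule subgroup_centralizer[OF u])
  interpret C: group ?C
    by (rule subgroup_imp_group[OF sub])
  have finC: "finite (centralizer u)"
    using fin by (simp add: centralizer_def)
  have pow: "x [^]\<^bsub>?C\<^esub> k = x [^] k" for x and k :: nat
    by (rule nat_pow_consistent[symmetric])
  have uC: "u \<in> centralizer u"
    using u by (simp add: centralizer_def)
  have "C.ord u = ord u"
    using C.ord_unique[of u "ord u"] uC u pow by (simp add: pow_eq_id)
  then obtain K :: "'a monoid" where K: "group K" "finite (carrier K)"
    "order K * ord u = order ?C"
    "card {v \<in> carrier K. v [^]\<^bsub>K\<^esub> s = \<one>\<^bsub>K\<^esub>} = card {v \<in> carrier ?C. v [^]\<^bsub>?C\<^esub> s = \<one>\<^bsub>?C\<^esub>}"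
    using C.card_roots_central_quotient[of u s] finC uC cop by (auto simp: centralizer_def)
  have oC: "order ?C = card (centralizer u)"
    by (simp add: order_def)
  have "card (centralizer u) \<le> order G"
    unfolding order_def using fin by (intro card_mono) (auto simp: centralizer_def)
  moreover have "order K > 0"
    using K(1,2) by (simp add: group.is_monoid monoid.order_gt_0_iff_finite)
  then have "order K < order K * ord u"
    using u1 by simp
  ultimately have "order K < order G"
    using K(3) oC by simp
  then have "gcd s (order K) dvd card {x \<in> carrier K. x [^]\<^bsub>K\<^esub> gcd s (order K) = \<one>\<^bsub>K\<^esub>}"
    using IH[of K "gcd s (order K)"] K by simp
  also have "card {x \<in> carrier K. x [^]\<^bsub>K\<^esub> gcd s (order K) = \<one>\<^bsub>K\<^esub>} = card {v \<in> centralizer u. v [^] s = \<one>}"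
    using group.roots_eq_roots_gcd_order[OF K(1,2), of s] K(4) pow by simp
  finally have "gcd s (order K) dvd card {v \<in> centralizer u. v [^] s = \<one>}" .
  moreover have "gcd s (card (centralizer u)) = gcd s (order K)"
    using K(3) oC cop by (metis coprime_commute gcd_mult_right_right_cancel)
  ultimately show ?thesis
    by simp
qed

text \<open>The summand is constant on conjugacy classes. The class of \<open>u\<close> has
  \<open>k\<close> elements with \<open>k * card (centralizer u) = order G\<close>, a multiple of
  \<open>s\<close>; hence \<open>s\<close> divides \<open>k * gcd s (card (centralizer u))\<close>,
  and so the contribution of the class.\<close>

lemma (in group) dvd_sum_centralizer_roots:
  fixes s P :: nat
  assumes fin: "finite (carrier G)" and P: "P > 1" and cop: "coprime P s" and s: "s dvd order G"
    and IH: "\<And>(K :: 'a monoid) s. group K \<Longrightarrow> finite (carrier K) \<Longrightarrow> order K < order G \<Longrightarrow>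
      s dvd order K \<Longrightarrow> s dvd card {x \<in> carrier K. x [^]\<^bsub>K\<^esub> s = \<one>\<^bsub>K\<^esub>}"
  shows "s dvd (\<Sum>u | u \<in> carrier G \<and> ord u = P. card {v \<in> centralizer u. v [^] s = \<one>})"
proof -
  let ?\<phi> = "\<lambda>g. \<lambda>h\<in>carrier G. g \<otimes> h \<otimes> inv g"
  interpret act: group_action G "carrier G" ?\<phi>
    by (rule action_by_conjugation)
  define r where "r u = card {v \<in> centralizer u. v [^] s = \<one>}" for u
  \<comment> \<open>Extending the count by 0 to the other orders gives a class function on the whole
    group, so that the orbits of conjugation on \<open>carrier G\<close> can be summed over.\<close>
  define f where "f u = (if ord u = P then r u else 0)" for u
    have com: "g \<otimes> v \<otimes> inv g \<otimes> (g \<otimes> w \<otimes> inv g) = g \<otimes> (v \<otimes> w) \<otimes> inv g"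
      if "g \<in> carrier G" "v \<in> carrier G" "w \<in> carrier G" for g v w
    proof -
      have "inv g \<otimes> (g \<otimes> (w \<otimes> inv g)) = w \<otimes> inv g"
      using that by (simp flip: m_assoc)
    then show ?thesis
      using that by (simp add: m_assoc)
  qed
  have conj_pow: "(g \<otimes> x \<otimes> inv g) [^] k = g \<otimes> x [^] k \<otimes> inv g"
    if "g \<in> carrier G" "x \<in> carrier G" for g x and k :: nat
  proof (induction k)
    case (Suc k)
    then show ?case
      using that com[of g "x [^] k" x] by simp
  qed (use that in simp)
  have conj_one: "g \<otimes> x \<otimes> inv g = \<one> \<longleftrightarrow> x = \<one>" if "g \<in> carrier G" "x \<in> carrier G" for g x
    using that by (simp add: inv_solve_right')
  have f_conj: "f (g \<otimes> u \<otimes> inv g) = f u" if g: "g \<in> carrier G" and u: "u \<in> carrier G" for g u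
  proof -
    have "ord (g \<otimes> u \<otimes> inv g) = ord u"
      using g u by (subst ord_unique) (auto simp: conj_pow conj_one pow_eq_id)
    moreover have "r (g \<otimes> u \<otimes> inv g) = r u"
    proof -
      have "bij_betw (\<lambda>v. g \<otimes> v \<otimes> inv g) {v \<in> centralizer u. v [^] s = \<one>}
              {v \<in> centralizer (g \<otimes> u \<otimes> inv g). v [^] s = \<one>}"
      proof (rule bij_betw_byWitness[where f' = "\<lambda>v. inv g \<otimes> v \<otimes> g"])
        have cancel: "inv g \<otimes> (g \<otimes> v \<otimes> inv g) \<otimes> g = v" if "g \<in> carrier G" "v \<in> carrier G" for g v
          using that by (metis conjugation_is_surj inv_closed inv_inv)
        show "\<forall>a\<in>{v \<in> centralizer u. v [^] s = \<one>}. inv g \<otimes> (g \<otimes> a \<otimes> inv g) \<otimes> g = a"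
          using g cancel by (auto simp: centralizer_def)
        show "\<forall>a'\<in>{v \<in> centralizer (g \<otimes> u \<otimes> inv g). v [^] s = \<one>}. g \<otimes> (inv g \<otimes> a' \<otimes> g) \<otimes> inv g = a'"
          using g conjugation_is_surj by (auto simp: centralizer_def)
        show "(\<lambda>v. g \<otimes> v \<otimes> inv g) ` {v \<in> centralizer u. v [^] s = \<one>}
          \<subseteq> {v \<in> centralizer (g \<otimes> u \<otimes> inv g). v [^] s = \<one>}"
          using g u by (auto simp: centralizer_def conj_pow com)
        show "(\<lambda>v. inv g \<otimes> v \<otimes> g) ` {v \<in> centralizer (g \<otimes> u \<otimes> inv g). v [^] s = \<one>}
          \<subseteq> {v \<in> centralizer u. v [^] s = \<one>}"
        proof (clarsimp simp: centralizer_def, intro conjI)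
          fix v assume v: "v \<in> carrier G" "v [^] s = \<one>"
            and c: "v \<otimes> (g \<otimes> u \<otimes> inv g) = g \<otimes> u \<otimes> inv g \<otimes> v"
          show "inv g \<otimes> v \<otimes> g \<in> carrier G"
            using g v by simp
          have "inv g \<otimes> (v \<otimes> (g \<otimes> u \<otimes> inv g)) \<otimes> g = inv g \<otimes> v \<otimes> g \<otimes> u"
            using com[of "inv g" v "g \<otimes> u \<otimes> inv g"] cancel g u v by simp
          moreover have "inv g \<otimes> (g \<otimes> u \<otimes> inv g \<otimes> v) \<otimes> g = u \<otimes> (inv g \<otimes> v \<otimes> g)"
            using com[of "inv g" "g \<otimes> u \<otimes> inv g" v] cancel g u v by simp
          ultimately show "inv g \<otimes> v \<otimes> g \<otimes> u = u \<otimes> (inv g \<otimes> v \<otimes> g)"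
            using c by simp
          show "(inv g \<otimes> v \<otimes> g) [^] s = \<one>"
            using conj_pow[of "inv g" v s] g v by simp
        qed
      qed
      then show ?thesis
        unfolding r_def by (rule bij_betw_same_card[symmetric])
    qed
    ultimately show ?thesis
      by (simp add: f_def)
  qed
  have "s dvd (\<Sum>u\<in>orb. f u)" if orb: "orb \<in> orbits G (carrier G) ?\<phi>" for orb
  proof -
    obtain u where u: "u \<in> carrier G" "orb = orbit G ?\<phi> u"
      using orb by (auto simp: orbits_def)
    have "(\<Sum>v\<in>orb. f v) = (\<Sum>v\<in>orb. f u)"
      using u f_conj by (intro sum.cong) (auto simp: orbit_def)
    then have "(\<Sum>v\<in>orb. f v) = card orb * f u"
      by simp
    moreover have "s dvd card orb * f u"
    proof (cases "ord u = P")
      case True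
      have "card orb * card (centralizer u) = order G"
        using act.orbit_stabilizer_theorem[OF u(1)] centralizer_eq_stabilizer[OF u(1)] u(2) by simp
      then have "s dvd gcd (card orb * s) (card orb * card (centralizer u))"
        using s by simp
      then have "s dvd card orb * gcd s (card (centralizer u))"
        by (simp flip: gcd_mult_distrib_nat)
      moreover have "gcd s (card (centralizer u)) dvd r u"
        unfolding r_def using True P cop by (intro gcd_dvd_card_centralizer_roots fin u(1) IH) auto
      ultimately show ?thesis
        using True by (auto simp: f_def intro: dvd_trans mult_dvd_mono)
    qed (simp add: f_def)
    ultimately show ?thesis
      by simp
  qed
  then have "s dvd (\<Sum>orb\<in>orbits G (carrier G) ?\<phi>. \<Sum>u\<in>orb. f u)"
    by (rule dvd_sum)
  also have "\<dots> = (\<Sum>u\<in>carrier G. f u)"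
    by (rule act.disjoint_sum[OF fin])
  also have "\<dots> = (\<Sum>u | u \<in> carrier G \<and> ord u = P. r u)"
    unfolding f_def using fin by (simp add: sum.If_cases Int_def)
  finally show ?thesis
    by (simp add: r_def)
qed

text \<open>Each \<open>x\<close> counted on the left is the product of its p-part \<open>u\<close>,
  of order exactly \<open>P\<close>, and its part \<open>v\<close> of order prime to
  \<open>p\<close>, and these commute. Both parts are powers of \<open>x\<close>, which makes the
  decomposition unique.\<close>

lemma (in group) card_roots_diff_eq_sum:
  fixes P P' s :: nat
  assumes fin: "finite (carrier G)" and p: "prime p" and P: "P = p ^ Suc e" and P': "P' = p ^ e"
    and cop: "coprime P s"
  shows "card {x \<in> carrier G. x [^] (P * s) = \<one> \<and> x [^] (P' * s) \<noteq> \<one>} =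
    (\<Sum>u | u \<in> carrier G \<and> ord u = P. card {v \<in> centralizer u. v [^] s = \<one>})"
proof -
  define A where "A = (SIGMA u:{u \<in> carrier G. ord u = P}. {v \<in> centralizer u. v [^] s = \<one>})"
  \<comment> \<open>\<open>i\<close> and \<open>j\<close> are the Chinese remainder idempotents
    modulo \<open>P * s\<close>: the power \<open>x [^] i\<close> extracts the p-part and
    \<open>x [^] j\<close> the other one.\<close>
  obtain i where i: "[i = 1] (mod P)" "[i = 0] (mod s)"
    using binary_chinese_remainder_nat[OF cop, of 1 0] by auto
  obtain j where j: "[j = 0] (mod P)" "[j = 1] (mod s)"
    using binary_chinese_remainder_nat[OF cop, of 0 1] by auto
  have ij: "[i + j = 1] (mod P * s)"
  proof (rule coprime_cong_mult_nat[OF _ _ cop])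
    show "[i + j = 1] (mod P)" 
      using cong_add[OF i(1) j(1)] by simp
    show "[i + j = 1] (mod s)" 
      using cong_add[OF i(2) j(2)] by simp
  qed
  have cong_pow: "x [^] a = x [^] b" if "x \<in> carrier G" "x [^] m = \<one>" "[a = b] (mod m)" for x and a b m :: nat
  proof -
    have "int m dvd int b - int a"
      using that(3) by (metis cong_iff_dvd_diff cong_int_iff cong_sym)
    moreover have "int (ord x) dvd int m"
      using that by (simp add: pow_eq_id)
    ultimately show ?thesis
      using int_pow_eq[OF that(1), of "int a" "int b"] dvd_trans by (auto simp: int_pow_int)
  qed
  have s_dvd_i: "s dvd i" and P_dvd_j: "P dvd j"
    using i j by (simp_all add: cong_0_iff)
  have "bij_betw (\<lambda>(u, v). u \<otimes> v) A {x \<in> carrier G. x [^] (P * s) = \<one> \<and> x [^] (P' * s) \<noteq> \<one>}"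
  proof (rule bij_betw_byWitness[where f' = "\<lambda>x. (x [^] i, x [^] j)"])
    have uv: "u \<in> carrier G" "ord u = P" "v \<in> carrier G" "v \<otimes> u = u \<otimes> v" "v [^] s = \<one>" "u [^] P = \<one>"
      "(u \<otimes> v) [^] k = u [^] k \<otimes> v [^] k"
      if "(u, v) \<in> A" for u v and k :: nat
      using that pow_ord_eq_1[of u] by (auto simp: A_def centralizer_def intro!: pow_mult_distrib)
    show "\<forall>a\<in>A. ((case a of (u, v) \<Rightarrow> u \<otimes> v) [^] i, (case a of (u, v) \<Rightarrow> u \<otimes> v) [^] j) = a"
    proof clarsimp
      fix u v assume A: "(u, v) \<in> A"
      note uv = uv[OF A]
      have "u [^] i = u" "u [^] j = \<one>"
        using cong_pow[of u P i 1] cong_pow[of u P j 0] uv i j by simp_all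
      moreover have "v [^] i = \<one>" "v [^] j = v"
        using cong_pow[of v s i 0] cong_pow[of v s j 1] uv i j by simp_all
      ultimately show "(u \<otimes> v) [^] i = u \<and> (u \<otimes> v) [^] j = v"
        using uv by simp
    qed
    have decomp: "x [^] i \<otimes> x [^] j = x" if "x \<in> carrier G" "x [^] (P * s) = \<one>" for x
      using that cong_pow[of x "P * s" "i + j" 1] ij by (simp add: nat_pow_mult)
    show "\<forall>x\<in>{x \<in> carrier G. x [^] (P * s) = \<one> \<and> x [^] (P' * s) \<noteq> \<one>}.
        (case (x [^] i, x [^] j) of (u, v) \<Rightarrow> u \<otimes> v) = x"
      using decomp by simp
    show "(\<lambda>(u, v). u \<otimes> v) ` A \<subseteq> {x \<in> carrier G. x [^] (P * s) = \<one> \<and> x [^] (P' * s) \<noteq> \<one>}"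
    proof clarsimp
      fix u v assume A: "(u, v) \<in> A"
      note uv = uv[OF A]
      have "\<not> P dvd P' * s"
      proof
        assume "P dvd P' * s"
        then have "P dvd P'"
          using cop by (simp add: coprime_dvd_mult_left_iff)
        then show False
          using p by (simp add: P P' prime_gt_0_nat)
      qed
      then have "u [^] (P' * s) \<noteq> \<one>"
        using uv by (simp add: pow_eq_id)
      moreover have "v [^] (P' * s) = \<one>" "v [^] (P * s) = \<one>" "u [^] (P * s) = \<one>"
        using pow_dvd_eq_one[OF uv(3,5), of "P' * s"] pow_dvd_eq_one[OF uv(3,5), of "P * s"]
          pow_dvd_eq_one[OF uv(1,6), of "P * s"] by simp_all
      ultimately show "u \<otimes> v \<in> carrier G \<and> (u \<otimes> v) [^] (P * s) = \<one> \<and> (u \<otimes> v) [^] (P' * s) \<noteq> \<one>"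
        using uv by simp
    qed
    show "(\<lambda>x. (x [^] i, x [^] j)) ` {x \<in> carrier G. x [^] (P * s) = \<one> \<and> x [^] (P' * s) \<noteq> \<one>} \<subseteq> A"
    proof clarsimp
      fix x assume x: "x \<in> carrier G" "x [^] (P * s) = \<one>" "x [^] (P' * s) \<noteq> \<one>"
      have com: "x [^] i \<otimes> x [^] j = x [^] j \<otimes> x [^] i"
        using x by (simp add: nat_pow_mult add.commute)
      have "(x [^] i) [^] P = \<one>" "(x [^] j) [^] s = \<one>"
        using x s_dvd_i P_dvd_j pow_dvd_eq_one[of x "P * s" "i * P"] pow_dvd_eq_one[of x "P * s" "j * s"]
        by (simp_all add: nat_pow_pow mult_dvd_mono mult.commute)
      have "ord (x [^] i) = P"
      proof (rule ccontr)
        \<comment> \<open>If the p-part had smaller order, that order would divide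
          \<open>P'\<close>, and then \<open>x [^] (P' * s)\<close> would be trivial.\<close>
        assume ne: "ord (x [^] i) \<noteq> P"
        have "ord (x [^] i) dvd P"
          using \<open>(x [^] i) [^] P = \<one>\<close> x by (simp add: pow_eq_id)
        then obtain l where l: "l \<le> Suc e" "ord (x [^] i) = p ^ l"
          using divides_primepow_nat[OF p, of "ord (x [^] i)" "Suc e"] unfolding P by blast
        then have "ord (x [^] i) dvd P'"
          using ne P P' by (auto simp: le_Suc_eq intro: le_imp_power_dvd)
        then have "(x [^] i) [^] (P' * s) = \<one>"
          using x by (simp add: pow_eq_id)
        moreover have "(x [^] j) [^] (P' * s) = \<one>"
          using x \<open>(x [^] j) [^] s = \<one>\<close> pow_dvd_eq_one[of "x [^] j" s "P' * s"] by simp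
        ultimately have "(x [^] i \<otimes> x [^] j) [^] (P' * s) = \<one>"
          using x com pow_mult_distrib[of "x [^] i" "x [^] j" "P' * s"] by simp
        then show False
          using decomp x by simp
      qed
      then show "(x [^] i, x [^] j) \<in> A"
        using x com \<open>(x [^] j) [^] s = \<one>\<close> by (simp add: A_def centralizer_def)
    qed
  qed
  then have "card {x \<in> carrier G. x [^] (P * s) = \<one> \<and> x [^] (P' * s) \<noteq> \<one>} = card A"
    by (rule bij_betw_same_card[symmetric])
  then show ?thesis
    using fin by (simp add: A_def centralizer_def)
qed

text \<open>Membership in the set depends only on the order of the element, so the set consists of
  all elements of certain orders \<open>d\<close>. Each such \<open>d\<close> is a multiple of
  \<open>p ^ Suc e\<close>, hence \<open>p ^ e\<close> divides \<open>totient d\<close>, and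
  \<open>totient d\<close> divides the number of elements of order \<open>d\<close>.\<close>

lemma (in group) prime_power_dvd_card_roots_diff:
  fixes s :: nat
  assumes fin: "finite (carrier G)" and p: "prime p"
    and cop: "coprime p s"
  shows "p ^ e dvd card {x \<in> carrier G. x [^] (p ^ Suc e * s) = \<one> \<and> x [^] (p ^ e * s) \<noteq> \<one>}" (is "_ dvd card ?X")
proof -
  have finX: "finite ?X"
    using fin by simp
  have "card ?X = (\<Sum>d\<in>ord ` ?X. card {x \<in> ?X. ord x = d})"
    using sum.image_gen[OF finX, of "\<lambda>_. 1::nat" ord] by simp
  moreover have "p ^ e dvd card {x \<in> ?X. ord x = d}" if d: "d \<in> ord ` ?X" for d
  proof -
    obtain x where x: "x \<in> carrier G" "d = ord x" "d dvd p ^ Suc e * s" "\<not> d dvd p ^ e * s"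
      using d by (auto simp: pow_eq_id simp del: power_Suc)
    have "{x \<in> ?X. ord x = d} = {x \<in> carrier G. ord x = d}"
      using x by (auto simp: pow_eq_id)
    then have "card {x \<in> ?X. ord x = d} = num_elems_ord G d"
      by (simp add: num_elems_ord_def)
    moreover have "p ^ Suc e dvd d"
    proof (rule ccontr)
      assume nd: "\<not> p ^ Suc e dvd d"
      obtain a b where ab: "d = a * b" "a dvd p ^ Suc e" "b dvd s"
        using x(3) division_decomp by blast
      obtain l where l: "l \<le> Suc e" "a = p ^ l"
        using divides_primepow_nat[OF p] ab(2) by blast
      have "l \<noteq> Suc e"
        using nd l ab by auto
      then have "d dvd p ^ e * s"
        using l ab by (auto simp: le_Suc_eq intro!: mult_dvd_mono le_imp_power_dvd)
      then show False
        using x by simp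
    qed
    then have "totient (p ^ Suc e) dvd totient d"
    proof -
      obtain k where k: "k \<ge> Suc e" "d = p ^ k * (d div p ^ k)" "coprime (p ^ k) (d div p ^ k)"
      proof -
        have "d > 0" 
          using x ord_pos[OF fin] by simp
        then have "d \<noteq> 0" "\<not> is_unit p" using p by auto
        then obtain m where m: "d = p ^ multiplicity p d * m" "\<not> p dvd m"
          using multiplicity_decompose'[of d p] by (metis mult.commute)
        have "multiplicity p d \<ge> Suc e"
          using \<open>p ^ Suc e dvd d\<close> \<open>d \<noteq> 0\<close> \<open>\<not> is_unit p\<close> by (intro multiplicity_geI) auto
        moreover have "m = d div p ^ multiplicity p d"
          using m p by (metis nonzero_mult_div_cancel_left not_prime_0 power_not_zero)
        ultimately show ?thesis
          using that[of "multiplicity p d"] m p by (simp add: prime_imp_coprime)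
      qed
      have "totient d = totient (p ^ k) * totient (d div p ^ k)"
        using totient_mult_coprime[OF k(3)] k(2) by simp
      moreover have "totient (p ^ Suc e) dvd totient (p ^ k)"
        using k(1) p by (auto simp: totient_prime_power totient_prime_power_Suc simp del: power_Suc
            intro!: mult_dvd_mono le_imp_power_dvd)
      ultimately show ?thesis
        by simp
    qed
    then have "p ^ e dvd totient d"
      using totient_prime_power_Suc[OF p, of e] by (metis dvd_mult_left)
    ultimately show ?thesis
      using totient_dvd_num_elems_ord[OF fin, of d] by (metis dvd_trans)
  qed
  ultimately show ?thesis
    by (simp add: dvd_sum)
qed

text \<open>Descending induction on \<open>n\<close>: for a prime \<open>p\<close> dividing \<open>order G div n\<close>, the roots for \<open>p * n\<close>
  that are not roots for \<open>n\<close> are products of an element \<open>u\<close> of prime power order and a root in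
  the centralizer of \<open>u\<close>, which are counted by passing to the quotient by \<open>u\<close>
  (the argument of Isaacs and Robinson).\<close>

lemma (in group) frobenius_step:
  assumes fin: "finite (carrier G)"
    and IH: "\<And>(K :: 'a monoid) s. group K \<Longrightarrow> finite (carrier K) \<Longrightarrow> order K < order G \<Longrightarrow>
      s dvd order K \<Longrightarrow> s dvd card {x \<in> carrier K. x [^]\<^bsub>K\<^esub> s = \<one>\<^bsub>K\<^esub>}"
    and n: "n dvd order G"
  shows "n dvd card {x \<in> carrier G. x [^] n = \<one>}"
  using n
proof (induction "order G div n" arbitrary: n rule: less_induct)
  case less
  have o: "order G > 0"
    using fin by (simp add: order_gt_0_iff_finite)
  then have npos: "n > 0"
    using less.prems by (auto intro: Nat.gr0I)
  show ?case
  proof (cases "n = order G")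
    case True
    then have "{x \<in> carrier G. x [^] n = \<one>} = carrier G"
      using pow_order_eq_1 by auto
    then show ?thesis
      using True by (simp add: order_def)
  next
    case False
    then have "order G div n \<noteq> 1"
      using less.prems by (metis dvd_mult_div_cancel mult.right_neutral)
    then obtain p where p: "prime p" "p dvd order G div n"
      using prime_factor_nat by blast
    then have np: "n * p dvd order G"
      using less.prems npos by (metis dvd_mult_div_cancel mult_dvd_mono dvd_refl)
    have "order G div (n * p) < order G div n"
      using p o less.prems prime_gt_1_nat[OF p(1)] npos
      by (simp add: div_mult2_eq div_less_dividend dvd_imp_le div_greater_zero_iff)
    then have 1: "n dvd card {x \<in> carrier G. x [^] (n * p) = \<one>}"
      using less.hyps np by (meson dvd_mult_left)
    obtain s where s: "n = p ^ multiplicity p n * s" "\<not> p dvd s"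
      using multiplicity_decompose'[of n p] npos p not_prime_unit by (metis mult.commute not_gr0)
    define e where "e = multiplicity p n"
    have ne: "n = p ^ e * s"
      using s by (simp add: e_def)
    have cop: "coprime p s"
      using s p by (simp add: prime_imp_coprime)
    then have cop': "coprime (p ^ Suc e) s"
      by simp
    have npe: "n * p = p ^ Suc e * s"
      by (simp add: ne)
    let ?X = "{x \<in> carrier G. x [^] (p ^ Suc e * s) = \<one> \<and> x [^] (p ^ e * s) \<noteq> \<one>}"
    \<comment> \<open>The coprime factors of \<open>n = p ^ e * s\<close> are handled by different
      arguments: \<open>s\<close> by the count over centralizers, \<open>p ^ e\<close> by the
      totients.\<close>
    have "s dvd card ?X"
      unfolding card_roots_diff_eq_sum[OF fin p(1) refl refl cop']
    proof (rule dvd_sum_centralizer_roots[OF fin])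
      show "p ^ Suc e > 1"
        using p prime_gt_1_nat by (intro one_less_power) auto
      show "coprime (p ^ Suc e) s"
        using cop by simp
      show "s dvd order G"
        using less.prems ne by (metis dvd_mult_right)
    qed (rule IH)
    moreover have "p ^ e dvd card ?X"
      by (rule prime_power_dvd_card_roots_diff[OF fin p(1) cop])
    ultimately have 2: "n dvd card ?X"
      unfolding ne using cop by (intro divides_mult) auto
    have X: "?X = {x \<in> carrier G. x [^] (n * p) = \<one> \<and> x [^] n \<noteq> \<one>}"
      by (unfold npe, unfold ne, rule refl)
    have "{x \<in> carrier G. x [^] (n * p) = \<one>} = {x \<in> carrier G. x [^] n = \<one>} \<union> ?X"
      using pow_dvd_eq_one[of _ n "n * p"] unfolding X by auto
    moreover have "{x \<in> carrier G. x [^] n = \<one>} \<inter> ?X = {}"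
      by (auto simp: ne)
    ultimately have "card {x \<in> carrier G. x [^] (n * p) = \<one>} = card {x \<in> carrier G. x [^] n = \<one>} + card ?X"
      using fin by (simp add: card_Un_disjoint)
    then show ?thesis
      using 1 2 by (simp add: dvd_add_left_iff)
  qed
qed

text \<open>An induction over groups has to stay within one record type. Plain
  \<open>'a monoid\<close> is chosen because the quotients are of this type; other record extensions
  are then reached by a single further application of the step.\<close>

lemma frobenius_monoid:
  fixes K :: "'a monoid"
  assumes "group K" "finite (carrier K)" "n dvd order K"
  shows "n dvd card {x \<in> carrier K. x [^]\<^bsub>K\<^esub> n = \<one>\<^bsub>K\<^esub>}"
  using assms
proof (induction "order K" arbitrary: K n rule: less_induct)
  case less
  show ?case
    by (rule group.frobenius_step[OF less.prems(1,2) _ less.prems(3)]) (rule less.hyps)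
qed

theorem (in group) frobenius:
  assumes "finite (carrier G)" "n dvd order G"
  shows "n dvd card {x \<in> carrier G. x [^] n = \<one>}"
  by (rule frobenius_step[OF assms(1) _ assms(2)]) (rule frobenius_monoid)

section \<open>Monomials\<close>

lemma sum_fun_apply: "(\<Sum>i\<in>A. f i) v = (\<Sum>i\<in>A. f i v)"
  by (induction A rule: infinite_finite_induct) auto

text \<open>The assumption concerns the indexed family, so a repeated member would give the
  nontrivial relation with coefficients 1 and -1. This is why injectivity comes together with the
  independence of the image set.\<close>

lemma cfun_family_independent:
  assumes fin: "finite I"
    and zero: "\<And>c. (\<And>v. (\<Sum>i\<in>I. c i * f i v) = 0) \<Longrightarrow> \<forall>i\<in>I. c i = 0"
  shows "inj_on f I" "cfun.independent (f ` I)"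
proof -
  show inj: "inj_on f I"
  proof (rule inj_onI, rule ccontr)
    fix i j assume ij: "i \<in> I" "j \<in> I" "f i = f j" "i \<noteq> j"
    define c :: "'a \<Rightarrow> complex" where "c k = (if k = i then 1 else if k = j then -1 else 0)" for k
    have "(\<Sum>k\<in>I. c k * f k v) = 0" for v
    proof -
      have "(\<Sum>k\<in>I. c k * f k v) = (\<Sum>k\<in>{i, j}. c k * f k v)"
        using fin ij by (intro sum.mono_neutral_right) (auto simp: c_def)
      also have "\<dots> = 0"
        using ij by (simp add: c_def)
      finally show ?thesis .
    qed
    then have "c i = 0"
      using zero ij by blast
    then show False
      by (simp add: c_def)
  qed
  show "cfun.independent (f ` I)"
  proof (rule cfun.independent_if_scalars_zero)
    show "finite (f ` I)"
      using fin by simp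
    fix u x assume sum0: "(\<Sum>x\<in>f ` I. cscale (u x) x) = 0" and "x \<in> f ` I"
    then obtain i where i: "i \<in> I" "x = f i"
      by auto
    have "(\<Sum>i\<in>I. u (f i) * f i v) = 0" for v
      using fun_cong[OF sum0, of v] inj by (simp add: sum.reindex sum_fun_apply cscale_def)
    then show "u x = 0"
      using zero[of "\<lambda>i. u (f i)"] i by auto
  qed
qed

lemma cfun_span_family:
  assumes fin: "finite I" and inj: "inj_on f I"
  shows "cfun.span (f ` I) = range (\<lambda>c v. \<Sum>i\<in>I. c i * f i v)"
proof
  show "cfun.span (f ` I) \<subseteq> range (\<lambda>c v. \<Sum>i\<in>I. c i * f i v)"
  proof
    fix x assume "x \<in> cfun.span (f ` I)"
    then obtain u where "x = (\<Sum>y\<in>f ` I. cscale (u y) y)"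
      using fin by (auto simp: cfun.span_finite)
    then have "x = (\<lambda>v. \<Sum>i\<in>I. u (f i) * f i v)"
      using inj by (auto simp: sum.reindex sum_fun_apply cscale_def)
    then show "x \<in> range (\<lambda>c v. \<Sum>i\<in>I. c i * f i v)"
      by (intro image_eqI[of _ _ "\<lambda>i. u (f i)"]) auto
  qed
next
  show "range (\<lambda>c v. \<Sum>i\<in>I. c i * f i v) \<subseteq> cfun.span (f ` I)"
  proof clarify
    fix c
    have "(\<lambda>v. \<Sum>i\<in>I. c i * f i v) = (\<Sum>i\<in>I. cscale (c i) (f i))"
      by (auto simp: sum_fun_apply cscale_def)
    then show "(\<lambda>v. \<Sum>i\<in>I. c i * f i v) \<in> cfun.span (f ` I)"
      by (simp only:) (intro cfun.span_sum cfun.span_scale cfun.span_base imageI)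
  qed
qed

definition exponents :: "'a set \<Rightarrow> nat \<Rightarrow> ('a \<Rightarrow> nat) set" where
  "exponents S m = {\<alpha>. (\<forall>x. x \<notin> S \<longrightarrow> \<alpha> x = 0) \<and> sum \<alpha> S = m}"

definition monomial :: "'a set \<Rightarrow> ('a \<Rightarrow> nat) \<Rightarrow> ('a \<Rightarrow> complex) \<Rightarrow> complex" where
  "monomial S \<alpha> v = (if v \<in> cfuns_on S then \<Prod>x\<in>S. v x ^ \<alpha> x else 0)"

text \<open>Stars and bars, after an enumeration of \<open>S\<close> has turned exponents into lists
  of given length and sum. For empty \<open>S\<close> the truncated subtraction still gives the
  right values: 1 for \<open>m = 0\<close>, and 0 otherwise.\<close>

lemma card_exponents:
  assumes fin: "finite S"
  shows "card (exponents S m) = (m + card S - 1) choose m"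
proof -
  obtain h where h: "bij_betw h {..<card S} S"
    using ex_bij_betw_nat_finite[OF fin] by (auto simp: atLeast0LessThan)
  define h' where "h' = the_inv_into {..<card S} h"
  have h': "h' x < card S" "h (h' x) = x" if "x \<in> S" for x
    using h that the_inv_into_into[of h "{..<card S}" x "{..<card S}"]
      f_the_inv_into_f[of h "{..<card S}" x] by (auto simp: bij_betw_def h'_def)
  have hh: "h i \<in> S" "h' (h i) = i" if "i < card S" for i
    using h that the_inv_into_f_f[of h "{..<card S}" i] by (auto simp: bij_betw_def h'_def)
  have "bij_betw (\<lambda>\<alpha>. map (\<lambda>i. \<alpha> (h i)) [0..<card S]) (exponents S m)
      {l. length l = card S \<and> sum_list l = m}"
  proof (rule bij_betw_byWitness[where f' = "\<lambda>l x. if x \<in> S then l ! h' x else 0"])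
    show "\<forall>\<alpha>\<in>exponents S m. (\<lambda>x. if x \<in> S then map (\<lambda>i. \<alpha> (h i)) [0..<card S] ! h' x else 0) = \<alpha>"
      using h' by (auto simp: exponents_def)
    show "\<forall>l\<in>{l. length l = card S \<and> sum_list l = m}.
        map (\<lambda>i. if h i \<in> S then l ! h' (h i) else 0) [0..<card S] = l"
      using hh by (auto intro!: nth_equalityI)
    have sum_h: "(\<Sum>i<card S. \<alpha> (h i)) = sum \<alpha> S" for \<alpha> :: "'a \<Rightarrow> nat"
      by (rule sum.reindex_bij_betw[OF h])
    show "(\<lambda>\<alpha>. map (\<lambda>i. \<alpha> (h i)) [0..<card S]) ` exponents S m \<subseteq> {l. length l = card S \<and> sum_list l = m}"
      using sum_h by (auto simp: exponents_def interv_sum_list_conv_sum_set_nat atLeast0LessThan)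
    show "(\<lambda>l x. if x \<in> S then l ! h' x else 0) ` {l. length l = card S \<and> sum_list l = m} \<subseteq> exponents S m"
    proof (clarsimp simp: exponents_def)
      fix l :: "nat list" assume l: "length l = card S"
      have "(\<Sum>x\<in>S. l ! h' x) = (\<Sum>i<card S. l ! h' (h i))"
        using sum_h[of "\<lambda>x. l ! h' x"] by simp
      also have "\<dots> = (\<Sum>i<card S. l ! i)"
        using hh by simp
      finally show "(\<Sum>x\<in>S. l ! h' x) = sum_list l"
        using l by (simp add: sum_list_sum_nth atLeast0LessThan)
    qed
  qed
  then have "card (exponents S m) = card {l :: nat list. length l = card S \<and> sum_list l = m}"
    by (rule bij_betw_same_card)
  then show ?thesis
    by (simp add: card_length_sum_list)
qed

lemma finite_exponents:
  assumes fin: "finite S"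
  shows "finite (exponents S m)"
proof -
  have "exponents S m \<subseteq> (\<lambda>f x. if x \<in> S then f x else 0) ` (S \<rightarrow>\<^sub>E {..m})"
  proof
    fix \<alpha> assume a: "\<alpha> \<in> exponents S m"
    then have "\<alpha> x \<le> m" if "x \<in> S" for x
      using member_le_sum[of x S \<alpha>] that fin by (auto simp: exponents_def)
    then have "restrict \<alpha> S \<in> S \<rightarrow>\<^sub>E {..m}"
      by auto
    moreover have "\<alpha> = (\<lambda>x. if x \<in> S then restrict \<alpha> S x else 0)"
      using a by (auto simp: exponents_def)
    ultimately show "\<alpha> \<in> (\<lambda>f x. if x \<in> S then f x else 0) ` (S \<rightarrow>\<^sub>E {..m})"
      by blast
  qed
  then show ?thesis
    using fin by (meson finite_PiE finite_atMost finite_imageI finite_subset)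
qed

text \<open>Monomials are distinct multiplicative characters of the monoid of vectors with the pointwise
  product, so Dedekind's argument applies.\<close>

lemma monomials_independent:
  assumes fin: "finite S" and finA: "finite A" and A: "\<And>\<alpha> x. \<alpha> \<in> A \<Longrightarrow> x \<notin> S \<Longrightarrow> \<alpha> x = 0"
    and zero: "\<And>v. v \<in> cfuns_on S \<Longrightarrow> (\<Sum>\<alpha>\<in>A. c \<alpha> * monomial S \<alpha> v) = 0"
  shows "\<forall>\<alpha>\<in>A. c \<alpha> = 0"
  using finA A zero
proof (induction A arbitrary: c rule: finite_induct)
  case (insert \<beta> A)
  have mult: "monomial S \<alpha> (\<lambda>x. v x * w x) = monomial S \<alpha> v * monomial S \<alpha> w"
    "(\<lambda>x. v x * w x) \<in> cfuns_on S"
    if "v \<in> cfuns_on S" "w \<in> cfuns_on S" for v w \<alpha>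
    using that by (auto simp: monomial_def cfuns_on_def power_mult_distrib prod.distrib)
  have "c \<alpha> = 0" if \<alpha>: "\<alpha> \<in> A" for \<alpha>
  proof -
    have "\<alpha> \<noteq> \<beta>"
      using \<alpha> insert.hyps by auto
    then obtain x where x: "\<alpha> x \<noteq> \<beta> x"
      by auto
    then have xS: "x \<in> S"
      using insert.prems(1)[of \<alpha> x] insert.prems(1)[of \<beta> x] \<alpha> by force
    \<comment> \<open>The value 2 at a coordinate where the exponents differ separates the two
      characters, because powers of 2 determine their exponents. Comparing the relation at
      \<open>v * w\<close> with \<open>monomial S \<beta> w\<close> times the relation at
      \<open>v\<close> eliminates \<open>\<beta>\<close>.\<close>
    define w :: "'a \<Rightarrow> complex" where "w y = (if y = x then 2 else if y \<in> S then 1 else 0)" for y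
    have w: "w \<in> cfuns_on S"
      using xS by (auto simp: w_def cfuns_on_def)
    have mw: "monomial S \<gamma> w = 2 ^ \<gamma> x" for \<gamma>
    proof -
      have "(\<Prod>y\<in>S. w y ^ \<gamma> y) = (\<Prod>y\<in>{x}. w y ^ \<gamma> y)"
        using fin xS by (intro prod.mono_neutral_right) (auto simp: w_def)
      then show ?thesis
        using w by (simp add: monomial_def w_def)
    qed
    have "\<forall>\<gamma>\<in>A. c \<gamma> * (monomial S \<gamma> w - monomial S \<beta> w) = 0"
    proof (rule insert.IH)
      fix v assume v: "v \<in> cfuns_on S"
      have "0 = (\<Sum>\<gamma>\<in>insert \<beta> A. c \<gamma> * monomial S \<gamma> (\<lambda>x. v x * w x))
          - monomial S \<beta> w * (\<Sum>\<gamma>\<in>insert \<beta> A. c \<gamma> * monomial S \<gamma> v)"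
        using insert.prems(2) v w mult(2) by simp
      also have "\<dots> = (\<Sum>\<gamma>\<in>insert \<beta> A. c \<gamma> * (monomial S \<gamma> w - monomial S \<beta> w) * monomial S \<gamma> v)"
        using v w mult(1) by (simp add: sum_distrib_left sum_subtractf[symmetric] algebra_simps del: sum.insert)
      also have "\<dots> = (\<Sum>\<gamma>\<in>A. c \<gamma> * (monomial S \<gamma> w - monomial S \<beta> w) * monomial S \<gamma> v)"
        using insert.hyps by simp
      finally show "(\<Sum>\<gamma>\<in>A. c \<gamma> * (monomial S \<gamma> w - monomial S \<beta> w) * monomial S \<gamma> v) = 0"
        by simp
    qed (use insert.prems(1) in blast)
    then have "c \<alpha> * (2 ^ \<alpha> x - 2 ^ \<beta> x) = 0"
      using \<alpha> by (simp add: mw)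
    moreover have "(2 :: complex) ^ \<alpha> x \<noteq> 2 ^ \<beta> x"
    proof
      assume "(2 :: complex) ^ \<alpha> x = 2 ^ \<beta> x"
      then have "of_nat (2 ^ \<alpha> x) = (of_nat (2 ^ \<beta> x) :: complex)"
        by simp
      then have "(2 :: nat) ^ \<alpha> x = 2 ^ \<beta> x"
        by (simp only: of_nat_eq_iff)
      then show False
        using x by simp
    qed
    ultimately show ?thesis
      by simp
  qed
  moreover have "c \<beta> = 0"
  proof -
    have "(\<lambda>x. if x \<in> S then 1 else 0) \<in> cfuns_on S"
      by (simp add: cfuns_on_def)
    from insert.prems(2)[OF this] show ?thesis
      using calculation insert.hyps \<open>(\<lambda>x. if x \<in> S then 1 else 0) \<in> cfuns_on S\<close> by (simp add: monomial_def)
  qed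
  ultimately show ?case
    by simp
qed simp

lemma monomials_basis:
  assumes fin: "finite S"
  shows "inj_on (monomial S) (exponents S m)"
    and "(\<And>v. (\<Sum>\<alpha>\<in>exponents S m. c \<alpha> * monomial S \<alpha> v) = 0) \<Longrightarrow> \<forall>\<alpha>\<in>exponents S m. c \<alpha> = 0"
proof -
  have zero: "\<forall>\<alpha>\<in>exponents S m. c \<alpha> = 0"
    if "\<And>v. (\<Sum>\<alpha>\<in>exponents S m. c \<alpha> * monomial S \<alpha> v) = 0" for c
    using that by (intro monomials_independent[OF fin finite_exponents[OF fin]]) (auto simp: exponents_def)
  show "inj_on (monomial S) (exponents S m)"
    by (rule cfun_family_independent(1)[OF finite_exponents[OF fin]]) (rule zero)
  show "(\<And>v. (\<Sum>\<alpha>\<in>exponents S m. c \<alpha> * monomial S \<alpha> v) = 0) \<Longrightarrow> \<forall>\<alpha>\<in>exponents S m. c \<alpha> = 0"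
    by (rule zero)
qed

section \<open>Products of linear forms versus monomials\<close>

lemma dual_space_expand:
  assumes fin: "finite S" and l: "l \<in> dual_space (cfuns_on S)" and v: "v \<in> cfuns_on S"
  shows "l v = (\<Sum>x\<in>S. l (\<lambda>y. if y = x then 1 else 0) * v x)"
proof -
  have add: "l (u + w) = l u + l w" and scale: "l (cscale c u) = c * l u"
    if "u \<in> cfuns_on S" "w \<in> cfuns_on S" for u w c
    using l that by (auto simp: dual_space_def)
  have expand: "l (\<lambda>y. if y \<in> T then v y else 0) = (\<Sum>x\<in>T. l (\<lambda>y. if y = x then 1 else 0) * v x)"
    if "T \<subseteq> S" for T
    using finite_subset[OF that fin] that
  proof (induction T rule: finite_induct)
    case empty
    have "l (cscale 0 v) = 0 * l v"
      using scale v by blast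
    then show ?case
      by (simp add: cscale_def)
  next
    case (insert x T)
    let ?e = "\<lambda>y. if y = x then 1 else 0 :: complex"
    let ?t = "\<lambda>y. if y \<in> T then v y else 0"
    have eq: "(\<lambda>y. if y \<in> insert x T then v y else 0) = cscale (v x) ?e + ?t"
      using insert.hyps by (auto simp: cscale_def)
    have mem: "cscale (v x) ?e \<in> cfuns_on S" "?e \<in> cfuns_on S" "?t \<in> cfuns_on S"
      using insert.prems by (auto simp: cfuns_on_def cscale_def)
    have "l (\<lambda>y. if y \<in> insert x T then v y else 0) = v x * l ?e + l ?t"
      by (simp only: eq add[OF mem(1,3)] scale[OF mem(2,2)])
    moreover have "l ?t = (\<Sum>x\<in>T. l (\<lambda>y. if y = x then 1 else 0) * v x)"
      using insert by blast
    ultimately show ?case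
      using insert.hyps by (simp add: mult.commute[of "v x"])
  qed
  have "(\<lambda>y. if y \<in> S then v y else 0) = v"
    using v by (auto simp: cfuns_on_def)
  then show ?thesis
    using expand[OF subset_refl] by (simp only:)
qed

lemma exponents_fun_upd:
  assumes "finite S" "\<alpha> \<in> exponents S m" "x \<in> S"
  shows "\<alpha>(x := Suc (\<alpha> x)) \<in> exponents S (Suc m)"
    "monomial S (\<alpha>(x := Suc (\<alpha> x))) v = v x * monomial S \<alpha> v"
proof -
  have "sum (\<alpha>(x := Suc (\<alpha> x))) S = Suc (sum \<alpha> S)"
    using assms by (simp add: sum.remove[of S x] cong: sum.cong_simp)
  then show "\<alpha>(x := Suc (\<alpha> x)) \<in> exponents S (Suc m)"
    using assms by (auto simp: exponents_def)
  show "monomial S (\<alpha>(x := Suc (\<alpha> x))) v = v x * monomial S \<alpha> v"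
    using assms by (simp add: monomial_def prod.remove[of S x] cong: prod.cong_simp)
qed

lemma coordinate_in_dual_space:
  assumes "x \<in> S"
  shows "(\<lambda>v. if v \<in> cfuns_on S then v x else 0) \<in> dual_space (cfuns_on S)"
  by (auto simp: dual_space_def cfuns_on_def cscale_def)

lemma monomial_is_product_of_linear_forms:
  assumes fin: "finite S" and "\<alpha> \<in> exponents S m"
  shows "\<exists>l. (\<forall>i<m. l i \<in> dual_space (cfuns_on S)) \<and>
    monomial S \<alpha> = (\<lambda>v. if v \<in> cfuns_on S then \<Prod>i<m. l i v else 0)"
  using assms(2)
proof (induction m arbitrary: \<alpha>)
  case 0
  then have "\<forall>x\<in>S. \<alpha> x = 0"
    using fin by (simp add: exponents_def)
  then show ?case
    by (intro exI[of _ undefined]) (simp add: monomial_def fun_eq_iff)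
next
  case (Suc m)
  then have "sum \<alpha> S \<noteq> 0"
    by (simp add: exponents_def)
  then obtain x where x: "x \<in> S" "\<alpha> x > 0"
    using fin by auto
  define \<beta> where "\<beta> = \<alpha>(x := \<alpha> x - 1)"
  have ab: "\<alpha> = \<beta>(x := Suc (\<beta> x))"
    using x by (auto simp: \<beta>_def)
  have "sum \<beta> S = m"
    using Suc.prems x fin by (simp add: exponents_def sum.remove[of S x] \<beta>_def cong: sum.cong_simp)
  then have \<beta>: "\<beta> \<in> exponents S m"
    using Suc.prems x by (auto simp: exponents_def \<beta>_def)
  then obtain l where l: "\<forall>i<m. l i \<in> dual_space (cfuns_on S)"
    "monomial S \<beta> = (\<lambda>v. if v \<in> cfuns_on S then \<Prod>i<m. l i v else 0)"
    using Suc.IH by blast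
  define l' where "l' = l(m := (\<lambda>v. if v \<in> cfuns_on S then v x else 0))"
  have "\<forall>i<Suc m. l' i \<in> dual_space (cfuns_on S)"
    using l coordinate_in_dual_space[OF x(1)] by (auto simp: l'_def less_Suc_eq)
  moreover have "monomial S \<alpha> = (\<lambda>v. if v \<in> cfuns_on S then \<Prod>i<Suc m. l' i v else 0)"
  proof
    fix v
    have "monomial S \<alpha> v = v x * monomial S \<beta> v"
      using exponents_fun_upd(2)[OF fin \<beta> x(1)] ab by simp
    then show "monomial S \<alpha> v = (if v \<in> cfuns_on S then \<Prod>i<Suc m. l' i v else 0)"
      by (simp add: l(2) l'_def)
  qed
  ultimately show ?case
    by blast
qed

text \<open>Expanded in coordinates, \<open>l\<close> is a combination of the functions
  \<open>v x\<close>, and multiplication by \<open>v x\<close> raises one exponent by one. This is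
  the induction step for turning products of linear forms into combinations of monomials.\<close>

lemma linear_form_times_monomials:
  assumes fin: "finite S" and l: "l \<in> dual_space (cfuns_on S)"
    and f: "f \<in> cfun.span (monomial S ` exponents S m)"
  shows "(\<lambda>v. f v * l v) \<in> cfun.span (monomial S ` exponents S (Suc m))"
  using f
proof (induction rule: cfun.span_induct_alt)
  case base
  then show ?case
    using cfun.span_zero by (simp add: zero_fun_def)
next
  case (step c g f)
  then obtain \<alpha> where \<alpha>: "\<alpha> \<in> exponents S m" "g = monomial S \<alpha>"
    by auto
  let ?l = "\<lambda>x. l (\<lambda>y. if y = x then 1 else 0)"
  have "(\<lambda>v. g v * l v) = (\<Sum>x\<in>S. cscale (?l x) (monomial S (\<alpha>(x := Suc (\<alpha> x)))))"
  proof
    fix v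
    show "g v * l v = (\<Sum>x\<in>S. cscale (?l x) (monomial S (\<alpha>(x := Suc (\<alpha> x))))) v"
    proof (cases "v \<in> cfuns_on S")
      case True
      have "(\<Sum>x\<in>S. cscale (?l x) (monomial S (\<alpha>(x := Suc (\<alpha> x))))) v
          = (\<Sum>x\<in>S. ?l x * (v x * monomial S \<alpha> v))"
        using exponents_fun_upd(2)[OF fin \<alpha>(1)] by (simp add: sum_fun_apply cscale_def)
      also have "\<dots> = g v * l v"
        unfolding dual_space_expand[OF fin l True] \<alpha>(2) by (simp add: sum_distrib_left mult_ac)
      finally show ?thesis ..
    next
      case False
      then show ?thesis
        by (simp add: sum_fun_apply cscale_def monomial_def \<alpha>(2))
    qed
  qed
  then have "(\<lambda>v. g v * l v) \<in> cfun.span (monomial S ` exponents S (Suc m))"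
    by (simp only:) (intro cfun.span_sum cfun.span_scale cfun.span_base imageI exponents_fun_upd(1) fin \<alpha>)
  then have "cscale c (\<lambda>v. g v * l v) + (\<lambda>v. f v * l v) \<in> cfun.span (monomial S ` exponents S (Suc m))"
    using step by (intro cfun.span_add cfun.span_scale)
  moreover have "cscale c (\<lambda>v. g v * l v) + (\<lambda>v. f v * l v) = (\<lambda>v. (cscale c g + f) v * l v)"
    by (auto simp: cscale_def algebra_simps)
  ultimately show ?case
    by simp
qed

lemma poly_funs_deg_eq_span_monomials:
  assumes fin: "finite S"
  shows "poly_funs_deg (cfuns_on S) m = cfun.span (monomial S ` exponents S m)"
proof
  have prod_in: "(\<lambda>v. if v \<in> cfuns_on S then \<Prod>i<m. l i v else 0) \<in> cfun.span (monomial S ` exponents S m)"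
    if "\<forall>i<m. l i \<in> dual_space (cfuns_on S)" for l
    using that
  proof (induction m)
    case 0
    have "(\<lambda>v. if v \<in> cfuns_on S then \<Prod>i<0. l i v else 0) = monomial S (\<lambda>_. 0)"
      by (auto simp: monomial_def)
    moreover have "(\<lambda>_. 0) \<in> exponents S 0"
      by (simp add: exponents_def)
    ultimately show ?case
      by (metis cfun.span_base imageI)
  next
    case (Suc m)
    have "(\<lambda>v. if v \<in> cfuns_on S then \<Prod>i<Suc m. l i v else 0) =
        (\<lambda>v. (if v \<in> cfuns_on S then \<Prod>i<m. l i v else 0) * l m v)"
      by auto
    moreover have "\<dots> \<in> cfun.span (monomial S ` exponents S (Suc m))"
      using Suc by (intro linear_form_times_monomials[OF fin]) auto
    ultimately show ?case
      by simp
  qed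
  show "poly_funs_deg (cfuns_on S) m \<subseteq> cfun.span (monomial S ` exponents S m)"
    unfolding poly_funs_deg_def using prod_in by (intro cfun.span_minimal) auto
  show "cfun.span (monomial S ` exponents S m) \<subseteq> poly_funs_deg (cfuns_on S) m"
    unfolding poly_funs_deg_def 
  proof (rule cfun.span_mono, clarify)
    fix \<alpha> assume "\<alpha> \<in> exponents S m"
    from monomial_is_product_of_linear_forms[OF fin this]
    show "\<exists>l. monomial S \<alpha> = (\<lambda>v. if v \<in> cfuns_on S then \<Prod>i<m. l i v else 0) \<and>
        (\<forall>i<m. l i \<in> dual_space (cfuns_on S))"
      by blast
  qed
qed

section \<open>Dimension of the invariants\<close>

text \<open>The formula is that of \<open>regular_rep\<close>, with exponents in place of
  coefficients: moving the vector and the exponents by the same \<open>g\<close> then leaves the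
  value of the monomial unchanged.\<close>

definition translate :: "('g, 'z) monoid_scheme \<Rightarrow> 'g \<Rightarrow> ('g \<Rightarrow> nat) \<Rightarrow> 'g \<Rightarrow> nat" where
  "translate G g \<alpha> = (\<lambda>x. if x \<in> carrier G then \<alpha> (inv\<^bsub>G\<^esub> g \<otimes>\<^bsub>G\<^esub> x) else 0)"

context group
begin

lemma bij_betw_left_mult:
  assumes g: "g \<in> carrier G"
  shows "bij_betw (\<lambda>x. g \<otimes> x) (carrier G) (carrier G)"
  by (rule bij_betw_byWitness[where f' = "\<lambda>x. inv g \<otimes> x"]) (use g in \<open>auto simp flip: m_assoc\<close>)

lemma translate_in_exponents:
  assumes g: "g \<in> carrier G" and a: "\<alpha> \<in> exponents (carrier G) m"
  shows "translate G g \<alpha> \<in> exponents (carrier G) m"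
proof -
  have "(\<Sum>x\<in>carrier G. \<alpha> (inv g \<otimes> x)) = sum \<alpha> (carrier G)"
    by (rule sum.reindex_bij_betw[OF bij_betw_left_mult]) (use g in simp)
  then show ?thesis
    using a by (simp add: exponents_def translate_def)
qed

lemma translate_one: "\<alpha> \<in> exponents (carrier G) m \<Longrightarrow> translate G \<one> \<alpha> = \<alpha>"
  by (auto simp: translate_def exponents_def)

lemma translate_mult:
  assumes "g \<in> carrier G" "h \<in> carrier G"
  shows "translate G (g \<otimes> h) \<alpha> = translate G g (translate G h \<alpha>)"
  using assms by (auto simp: translate_def fun_eq_iff inv_mult_group m_assoc)

lemma group_action_translate:
  "group_action G (exponents (carrier G) m) (\<lambda>g. \<lambda>\<alpha>\<in>exponents (carrier G) m. translate G g \<alpha>)"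
proof -
  let ?E = "exponents (carrier G) m"
  have bij: "bij_betw (translate G g) ?E ?E" if g: "g \<in> carrier G" for g
  proof (rule bij_betw_byWitness[where f' = "translate G (inv g)"])
    show "\<forall>\<alpha>\<in>?E. translate G (inv g) (translate G g \<alpha>) = \<alpha>"
      using g translate_one by (simp flip: translate_mult)
    show "\<forall>\<alpha>\<in>?E. translate G g (translate G (inv g) \<alpha>) = \<alpha>"
      using g translate_one by (simp flip: translate_mult)
  qed (use g translate_in_exponents in auto)
  then have Bij: "(\<lambda>\<alpha>\<in>?E. translate G g \<alpha>) \<in> Bij ?E" if "g \<in> carrier G" for g
    using that by (auto simp: Bij_def cong: bij_betw_cong)
  have "(\<lambda>\<alpha>\<in>?E. translate G (g \<otimes> h) \<alpha>) = compose ?E (\<lambda>\<alpha>\<in>?E. translate G g \<alpha>) (\<lambda>\<alpha>\<in>?E. translate G h \<alpha>)"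
    if "g \<in> carrier G" "h \<in> carrier G" for g h
    using that translate_in_exponents by (auto simp: compose_def translate_mult restrict_def fun_eq_iff)
  then have "(\<lambda>g. \<lambda>\<alpha>\<in>?E. translate G g \<alpha>) \<in> hom G (BijGroup ?E)"
    using Bij by (auto simp: hom_def BijGroup_def)
  then show ?thesis
    using group_BijGroup is_group by (simp add: group_action_def group_hom_def group_hom_axioms_def)
qed

lemma monomial_regular_rep:
  assumes g: "g \<in> carrier G" and v: "v \<in> regular_space G"
  shows "monomial (carrier G) (translate G g \<alpha>) (regular_rep G g v) = monomial (carrier G) \<alpha> v"
proof -
  have "(\<Prod>x\<in>carrier G. v (inv g \<otimes> x) ^ \<alpha> (inv g \<otimes> x)) = (\<Prod>x\<in>carrier G. v x ^ \<alpha> x)"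
    by (rule prod.reindex_bij_betw[OF bij_betw_left_mult]) (use g in simp)
  moreover have "regular_rep G g v \<in> cfuns_on (carrier G)"
    by (simp add: regular_rep_def cfuns_on_def)
  ultimately show ?thesis
    using v by (simp add: monomial_def translate_def regular_rep_def regular_space_def)
qed

text \<open>The orbit sums of the monomials form a basis of the invariants.\<close>

lemma dim_invariants_eq_card_orbits:
  fixes m :: nat
  assumes fin: "finite (carrier G)"
  defines "E \<equiv> exponents (carrier G) m"
  shows "cfun.dim (invariant_poly_funs_deg G (regular_space G) (regular_rep G) m) =
    card (orbits G E (\<lambda>g. \<lambda>\<alpha>\<in>E. translate G g \<alpha>))"
proof -
  let ?\<phi> = "\<lambda>g. \<lambda>\<alpha>\<in>E. translate G g \<alpha>"
  let ?V = "regular_space G"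
  let ?I = "invariant_poly_funs_deg G ?V (regular_rep G) m"
  let ?O = "orbits G E ?\<phi>"
  define M where "M = monomial (carrier G)"
  define s where "s orb v = (\<Sum>\<alpha>\<in>orb. M \<alpha> v)" for orb v
  interpret act: group_action G E ?\<phi>
    unfolding E_def by (rule group_action_translate)
  have finE: "finite E"
    using finite_exponents[OF fin] by (simp add: E_def)
  have injM: "inj_on M E"
    using monomials_basis(1)[OF fin] by (simp add: E_def M_def)
  have M_zero: "\<forall>\<alpha>\<in>E. c \<alpha> = 0" if "\<And>v. (\<Sum>\<alpha>\<in>E. c \<alpha> * M \<alpha> v) = 0" for c
    unfolding E_def by (rule monomials_basis(2)[OF fin]) (use that in \<open>simp add: E_def M_def\<close>)
  have M_out: "M \<alpha> v = 0" if "v \<notin> ?V" for \<alpha> v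
    using that by (simp add: M_def monomial_def regular_space_def)
  have deg: "poly_funs_deg ?V m = range (\<lambda>c v. \<Sum>\<alpha>\<in>E. c \<alpha> * M \<alpha> v)"
    using poly_funs_deg_eq_span_monomials[OF fin, of m] cfun_span_family[OF finE injM]
    by (simp add: regular_space_def E_def M_def)
  have I: "f \<in> ?I \<longleftrightarrow> f \<in> poly_funs_deg ?V m \<and> (\<forall>g\<in>carrier G. \<forall>v\<in>?V. f (regular_rep G g v) = f v)" for f
    using cfun.span_superset[of "\<Union>m. poly_funs_deg ?V m"]
    by (auto simp: invariant_poly_funs_deg_def invariant_poly_funs_def poly_funs_def)
  have finO: "finite ?O"
    using finE by (simp add: orbits_def)
  have orb_sub: "orb \<subseteq> E" if "orb \<in> ?O" for orb
    using act.orbits_coverture that by blast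
  have by_orbits: "(\<Sum>\<alpha>\<in>E. h \<alpha>) = (\<Sum>orb\<in>?O. \<Sum>\<alpha>\<in>orb. h \<alpha>)" for h :: "_ \<Rightarrow> complex"
    using act.disjoint_sum[OF finE] by metis
  \<comment> \<open>Spreads the coefficient of an orbit sum over the exponents in the orbit. A
    relation between orbit sums thus becomes one between monomials, with coefficients that are
    constant on orbits.\<close>
  define c where "c d \<alpha> = (d (orbit G ?\<phi> \<alpha>) :: complex)" for d \<alpha>
  have orb_eq: "orbit G ?\<phi> \<alpha> = orb" if "orb \<in> ?O" "\<alpha> \<in> orb" for orb \<alpha>
  proof -
    have "\<alpha> \<in> E"
      using orb_sub that by blast
    then have "orbit G ?\<phi> \<alpha> \<in> ?O" "\<alpha> \<in> orbit G ?\<phi> \<alpha>"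
      using act.orbit_refl by (auto simp: orbits_def)
    then show ?thesis
      using act.disjoint_union that by blast
  qed
  have comb: "(\<Sum>orb\<in>?O. d orb * s orb v) = (\<Sum>\<alpha>\<in>E. c d \<alpha> * M \<alpha> v)" for d v
  proof -
    have "(\<Sum>\<alpha>\<in>E. c d \<alpha> * M \<alpha> v) = (\<Sum>orb\<in>?O. \<Sum>\<alpha>\<in>orb. d orb * M \<alpha> v)"
      unfolding by_orbits c_def using orb_eq by (intro sum.cong refl) auto
    then show ?thesis
      by (simp add: s_def sum_distrib_left)
  qed
  have s_zero: "\<forall>orb\<in>?O. d orb = 0" if "\<And>v. (\<Sum>orb\<in>?O. d orb * s orb v) = 0" for d
  proof
    fix orb assume orb: "orb \<in> ?O"
    then obtain \<alpha> where \<alpha>: "\<alpha> \<in> E" "orb = orbit G ?\<phi> \<alpha>"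
      by (auto simp: orbits_def)
    have "c d \<alpha> = 0"
      using M_zero[of "c d"] that comb \<alpha> by simp
    then show "d orb = 0"
      using \<alpha> by (simp add: c_def)
  qed
  note basis = cfun_family_independent[OF finO, of s, OF s_zero]
  have span_s: "cfun.span (s ` ?O) = range (\<lambda>d v. \<Sum>orb\<in>?O. d orb * s orb v)"
    by (rule cfun_span_family[OF finO basis(1)])
  have translate_bij: "bij_betw (translate G g) E E" if "g \<in> carrier G" for g
    using act.bij_prop0[OF that] by (simp add: Bij_def cong: bij_betw_cong)
  show ?thesis
  proof (rule cfun.dim_unique)
    show "s ` ?O \<subseteq> ?I"
    proof clarify
      fix orb assume orb: "orb \<in> ?O"
      have "s orb \<in> cfun.span (s ` ?O)"
        using orb by (intro cfun.span_base) auto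
      then have "s orb \<in> poly_funs_deg ?V m"
        unfolding span_s deg comb by auto
      moreover have "s orb (regular_rep G g v) = s orb v" if g: "g \<in> carrier G" and v: "v \<in> ?V" for g v
      proof -
        have tr: "translate G g \<alpha> \<in> orb \<longleftrightarrow> \<alpha> \<in> orb" if "\<alpha> \<in> E" for \<alpha>
        proof -
          have "?\<phi> g \<alpha> \<in> orbit G ?\<phi> \<alpha>"
            using g unfolding orbit_def by blast
          then have o: "translate G g \<alpha> \<in> orbit G ?\<phi> \<alpha>"
            using that by simp
          moreover have "orbit G ?\<phi> \<alpha> \<in> ?O" "\<alpha> \<in> orbit G ?\<phi> \<alpha>"
            using that act.orbit_refl by (auto simp: orbits_def)
          ultimately show ?thesis
            using act.disjoint_union orb by blast
        qed
        have bij: "bij_betw (translate G g) orb orb"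
          unfolding bij_betw_def
        proof
          show "inj_on (translate G g) orb"
            using translate_bij[OF g] orb_sub[OF orb] by (meson bij_betw_imp_inj_on inj_on_subset)
          show "translate G g ` orb = orb"
          proof
            show "translate G g ` orb \<subseteq> orb"
              using tr orb_sub[OF orb] by auto
            show "orb \<subseteq> translate G g ` orb"
            proof
              fix \<beta> assume \<beta>: "\<beta> \<in> orb"
              then have "\<beta> \<in> translate G g ` E"
                using orb_sub[OF orb] translate_bij[OF g] by (auto simp: bij_betw_def)
              then show "\<beta> \<in> translate G g ` orb"
                using tr \<beta> by auto
            qed
          qed
        qed
        have "s orb (regular_rep G g v) = (\<Sum>\<alpha>\<in>orb. M (translate G g \<alpha>) (regular_rep G g v))"
          unfolding s_def by (rule sum.reindex_bij_betw[OF bij, symmetric])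
        then show ?thesis
          using monomial_regular_rep[OF g v] by (simp add: s_def M_def)
      qed
      ultimately show "s orb \<in> ?I"
        unfolding I by blast
    qed
    show "?I \<subseteq> cfun.span (s ` ?O)"
    proof
      fix f assume "f \<in> ?I"
      then obtain a where f: "f = (\<lambda>v. \<Sum>\<alpha>\<in>E. a \<alpha> * M \<alpha> v)"
        and inv: "\<And>g v. g \<in> carrier G \<Longrightarrow> v \<in> ?V \<Longrightarrow> f (regular_rep G g v) = f v"
        unfolding I deg by auto
      \<comment> \<open>Comparison of coefficients in \<open>f (regular_rep G g v) = f v\<close>:
        reindexing the sum by \<open>translate G g\<close> expresses both sides through the same
        monomials in \<open>v\<close>.\<close>
      have a_inv: "a (translate G g \<alpha>) = a \<alpha>" if g: "g \<in> carrier G" and \<alpha>: "\<alpha> \<in> E" for g \<alpha>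
      proof -
        have "(\<Sum>\<alpha>\<in>E. (a (translate G g \<alpha>) - a \<alpha>) * M \<alpha> v) = 0" for v
        proof (cases "v \<in> ?V")
          case True
          have "f (regular_rep G g v) = (\<Sum>\<alpha>\<in>E. a (translate G g \<alpha>) * M (translate G g \<alpha>) (regular_rep G g v))"
            unfolding f by (rule sum.reindex_bij_betw[OF translate_bij[OF g], symmetric])
          also have "\<dots> = (\<Sum>\<alpha>\<in>E. a (translate G g \<alpha>) * M \<alpha> v)"
            using monomial_regular_rep[OF g True] by (simp add: M_def)
          finally show ?thesis
            using inv[OF g True] by (simp add: f left_diff_distrib sum_subtractf)
        qed (simp add: M_out)
        then show ?thesis
          using M_zero[of "\<lambda>\<alpha>. a (translate G g \<alpha>) - a \<alpha>"] \<alpha> by simp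
      qed
      \<comment> \<open>By \<open>a_inv\<close> the coefficient does not depend on which element of
        the orbit is chosen.\<close>
      define d where "d orb = a (SOME \<alpha>. \<alpha> \<in> orb)" for orb
      have "c d \<alpha> = a \<alpha>" if \<alpha>: "\<alpha> \<in> E" for \<alpha>
      proof -
        have "(SOME \<beta>. \<beta> \<in> orbit G ?\<phi> \<alpha>) \<in> orbit G ?\<phi> \<alpha>"
          using act.orbit_refl[OF \<alpha>] by (rule someI[of "\<lambda>\<beta>. \<beta> \<in> orbit G ?\<phi> \<alpha>"])
        then obtain g where "g \<in> carrier G" "(SOME \<beta>. \<beta> \<in> orbit G ?\<phi> \<alpha>) = translate G g \<alpha>"
          using \<alpha> by (auto simp: orbit_def)
        then show ?thesis
          using a_inv \<alpha> by (simp add: c_def d_def)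
      qed
      then have "f = (\<lambda>v. \<Sum>orb\<in>?O. d orb * s orb v)"
        unfolding f comb by (intro ext sum.cong) auto
      then show "f \<in> cfun.span (s ` ?O)"
        unfolding span_s by blast
    qed
    show "cfun.independent (s ` ?O)"
      by (rule basis(2))
    show "card (s ` ?O) = card ?O"
      by (rule card_image[OF basis(1)])
  qed
qed

text \<open>A fixed exponent vector is constant on the right cosets of the subgroup generated by \<open>g\<close>.\<close>

lemma card_translate_invariants:
  fixes m :: nat
  assumes fin: "finite (carrier G)" and g: "g \<in> carrier G"
  defines "E \<equiv> exponents (carrier G) m"
  shows "card {\<alpha> \<in> E. translate G g \<alpha> = \<alpha>} =
    (if ord g dvd m then (m div ord g + order G div ord g - 1) choose (m div ord g) else 0)"
proof -
  define U where "U = generate G {g}"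
  define K where "K = rcosets U"
  have subU: "subgroup U G"
    using generate_is_subgroup[of "{g}"] g by (simp add: U_def)
  have cardU: "card U = ord g"
    using generate_pow_card[OF g] by (simp add: U_def)
  have UG: "U \<subseteq> carrier G"
    using subU by (rule subgroup.subset)
  have finK: "finite K"
    using fin rcosets_part_G[OF subU] by (simp add: K_def finite_UnionD)
  have cardK: "card K = order G div ord g"
    using lagrange[OF subU] cardU ord_pos[OF fin g] by (metis K_def div_mult_self_is_m)
  have mem: "U #> x \<in> K" "x \<in> U #> x" if "x \<in> carrier G" for x
    using that rcosetsI[OF UG] rcos_self[OF that subU] by (auto simp: K_def)
  have coset_g: "U #> (inv g \<otimes> x) = U #> x" if x: "x \<in> carrier G" for x
  proof -
    have "inv g \<in> U"
      using subU g by (simp add: U_def generate.incl subgroup.m_inv_closed)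
    then have "inv g \<otimes> x \<in> U #> x"
      by (auto simp: r_coset_def)
    then show ?thesis
      using repr_independence[OF _ x subU] by simp
  qed
  have const: "\<alpha> y = \<alpha> x" if \<alpha>: "\<alpha> \<in> E" "translate G g \<alpha> = \<alpha>" and x: "x \<in> carrier G" and y: "y \<in> U #> x" for \<alpha> x y
  proof -
    have step: "\<alpha> (g \<otimes> z) = \<alpha> z" if z: "z \<in> carrier G" for z
    proof -
      have "\<alpha> (g \<otimes> z) = translate G g \<alpha> (g \<otimes> z)"
        using \<alpha> by simp
      also have "\<dots> = \<alpha> z"
        using g z by (simp add: translate_def flip: m_assoc)
      finally show ?thesis .
    qed
    obtain k :: nat where k: "y = g [^] k \<otimes> x"
      using y generate_pow_on_finite_carrier[OF fin g] by (auto simp: U_def r_coset_def)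
    have "\<alpha> (g [^] k \<otimes> x) = \<alpha> x"
    proof (induction k)
      case (Suc k)
      have "g [^] Suc k \<otimes> x = g \<otimes> (g [^] k \<otimes> x)"
        using g x nat_pow_Suc2[OF g, of k] by (simp add: m_assoc)
      then show ?case
        using Suc step[of "g [^] k \<otimes> x"] g x by simp
    qed (use x in simp)
    then show ?thesis
      using k by simp
  qed
  have sum_cosets: "(\<Sum>x\<in>carrier G. \<beta> (U #> x)) = ord g * sum \<beta> K" for \<beta> :: "'a set \<Rightarrow> nat"
  proof -
    have "(\<Sum>x\<in>carrier G. \<beta> (U #> x)) = (\<Sum>C\<in>(\<lambda>x. U #> x) ` carrier G. \<Sum>x | x \<in> carrier G \<and> U #> x = C. \<beta> (U #> x))"
      by (rule sum.image_gen[OF fin])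
    also have "(\<lambda>x. U #> x) ` carrier G = K"
      by (auto simp: K_def RCOSETS_def)
    also have "(\<Sum>C\<in>K. \<Sum>x | x \<in> carrier G \<and> U #> x = C. \<beta> (U #> x)) = (\<Sum>C\<in>K. ord g * \<beta> C)"
    proof (rule sum.cong)
      fix C assume C: "C \<in> K"
      have "{x. x \<in> carrier G \<and> U #> x = C} = C"
      proof
        show "{x. x \<in> carrier G \<and> U #> x = C} \<subseteq> C"
          using mem by auto
        show "C \<subseteq> {x. x \<in> carrier G \<and> U #> x = C}"
        proof
          fix x assume x: "x \<in> C"
          obtain z where z: "z \<in> carrier G" "C = U #> z"
            using C by (auto simp: K_def RCOSETS_def)
          then show "x \<in> {x. x \<in> carrier G \<and> U #> x = C}"
            using x repr_independence[OF _ z(1) subU, of x] r_coset_subset_G[OF UG z(1)] by auto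
        qed
      qed
      moreover have "card C = ord g"
        using card_rcosets_equal[OF _ UG] C cardU by (simp add: K_def)
      moreover have "(\<Sum>x | x \<in> carrier G \<and> U #> x = C. \<beta> (U #> x)) = (\<Sum>x | x \<in> carrier G \<and> U #> x = C. \<beta> C)"
        by (rule sum.cong) auto
      ultimately show "(\<Sum>x | x \<in> carrier G \<and> U #> x = C. \<beta> (U #> x)) = ord g * \<beta> C"
        by simp
    qed simp
    also have "\<dots> = ord g * sum \<beta> K"
      by (simp add: sum_distrib_left)
    finally show ?thesis .
  qed
  \<comment> \<open>Each coset has \<open>ord g\<close> elements, so the fixed exponent vectors of
    degree \<open>m\<close> correspond to exponent vectors on the cosets of degree
    \<open>m div ord g\<close>, and there are none unless \<open>ord g\<close> divides
    \<open>m\<close>.\<close>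
  define B where "B = {\<beta>. (\<forall>C. C \<notin> K \<longrightarrow> \<beta> C = 0) \<and> ord g * sum \<beta> K = m}"
  have "bij_betw (\<lambda>\<beta> x. if x \<in> carrier G then \<beta> (U #> x) else 0) B {\<alpha> \<in> E. translate G g \<alpha> = \<alpha>}"
  proof (rule bij_betw_byWitness[where f' = "\<lambda>\<alpha> C. if C \<in> K then \<alpha> (SOME x. x \<in> C) else 0"])
    have some: "(SOME x. x \<in> C) \<in> C" "(SOME x. x \<in> C) \<in> carrier G" "U #> (SOME x. x \<in> C) = C" if C: "C \<in> K" for C
    proof -
      obtain z where z: "z \<in> carrier G" "C = U #> z"
        using C by (auto simp: K_def RCOSETS_def)
      show 1: "(SOME x. x \<in> C) \<in> C"
        using mem(2)[OF z(1)] unfolding z(2) by (rule someI)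
      show "(SOME x. x \<in> C) \<in> carrier G"
        using 1 r_coset_subset_G[OF UG z(1)] z(2) by auto
      show "U #> (SOME x. x \<in> C) = C"
        using 1 repr_independence[OF _ z(1) subU] z(2) by metis
    qed
    show "\<forall>\<beta>\<in>B. (\<lambda>C. if C \<in> K then if (SOME x. x \<in> C) \<in> carrier G then \<beta> (U #> (SOME x. x \<in> C)) else 0 else 0) = \<beta>"
      using some by (auto simp: B_def)
    have const': "\<alpha> (SOME z. z \<in> U #> x) = \<alpha> x"
      if "\<alpha> \<in> E" "translate G g \<alpha> = \<alpha>" "x \<in> carrier G" for \<alpha> x
      using const[OF that] some(1)[OF mem(1)[OF that(3)]] by simp
    show "\<forall>\<alpha>\<in>{\<alpha> \<in> E. translate G g \<alpha> = \<alpha>}.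
        (\<lambda>x. if x \<in> carrier G then if U #> x \<in> K then \<alpha> (SOME y. y \<in> U #> x) else 0 else 0) = \<alpha>"
      using const' mem(1) by (auto simp: E_def exponents_def fun_eq_iff)
    show "(\<lambda>\<beta> x. if x \<in> carrier G then \<beta> (U #> x) else 0) ` B \<subseteq> {\<alpha> \<in> E. translate G g \<alpha> = \<alpha>}"
      using sum_cosets g coset_g by (auto simp: B_def E_def exponents_def translate_def fun_eq_iff)
    show "(\<lambda>\<alpha> C. if C \<in> K then \<alpha> (SOME x. x \<in> C) else 0) ` {\<alpha> \<in> E. translate G g \<alpha> = \<alpha>} \<subseteq> B"
    proof clarify
      fix \<alpha> assume \<alpha>: "\<alpha> \<in> E" "translate G g \<alpha> = \<alpha>"
      have "ord g * (\<Sum>C\<in>K. \<alpha> (SOME x. x \<in> C)) = (\<Sum>x\<in>carrier G. \<alpha> (SOME z. z \<in> U #> x))"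
        by (rule sum_cosets[symmetric])
      also have "\<dots> = m"
        using const'[OF \<alpha>] \<alpha> by (simp add: E_def exponents_def)
      finally show "(\<lambda>C. if C \<in> K then \<alpha> (SOME x. x \<in> C) else 0) \<in> B"
        by (simp add: B_def)
    qed
  qed
  then have "card {\<alpha> \<in> E. translate G g \<alpha> = \<alpha>} = card B"
    by (rule bij_betw_same_card[symmetric])
  also have "card B = (if ord g dvd m then (m div ord g + order G div ord g - 1) choose (m div ord g) else 0)"
  proof (cases "ord g dvd m")
    case True
    then have "B = exponents K (m div ord g)"
      using ord_pos[OF fin g] by (auto simp: B_def exponents_def)
    then show ?thesis
      using True card_exponents[OF finK] cardK by simp
  next
    case False
    then have "B = {}"
      by (auto simp: B_def)
    then show ?thesis
      using False by simp
  qed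
  finally show ?thesis .
qed

lemma sum_elems_by_ord:
  fixes F :: "nat \<Rightarrow> nat"
  assumes fin: "finite (carrier G)"
  shows "(\<Sum>g\<in>carrier G. F (ord g)) = (\<Sum>d | d dvd order G. num_elems_ord G d * F d)"
proof -
  have "order G > 0"
    using fin by (simp add: order_gt_0_iff_finite)
  then have finD: "finite {d. d dvd order G}"
    by simp
  have "(\<Sum>g\<in>carrier G. F (ord g)) = (\<Sum>d | d dvd order G. \<Sum>g | g \<in> carrier G \<and> ord g = d. F (ord g))"
    using ord_dvd_group_order by (intro sum.group[OF fin finD, symmetric]) auto
  then show ?thesis
    by (simp add: num_elems_ord_def)
qed

text \<open>The factor \<open>order G + m\<close> is what makes the weights symmetric. With
  \<open>n = order G = d * a\<close> and \<open>m = d * b\<close>, Burnside's lemma produces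
  \<open>a + b - 1 choose b\<close>, and
  \<open>(n + m) * (a + b - 1 choose b) = n * (a + b choose a)\<close> by symmetry and absorption.
  The factor \<open>n\<close> then cancels against the group order in Burnside's lemma.\<close>

lemma dim_invariants_formula:
  assumes fin: "finite (carrier G)"
  shows "(order G + m) * cfun.dim (invariant_poly_funs_deg G (regular_space G) (regular_rep G) m) =
    (\<Sum>d | d dvd gcd (order G) m. num_elems_ord G d * ((order G + m) div d choose (order G div d)))"
proof -
  let ?dim = "cfun.dim (invariant_poly_funs_deg G (regular_space G) (regular_rep G) m)"
  let ?n = "order G"
  let ?E = "exponents (carrier G) m"
  let ?\<phi> = "\<lambda>g. \<lambda>\<alpha>\<in>?E. translate G g \<alpha>"
  interpret act: group_action G ?E ?\<phi>
    by (rule group_action_translate)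
  have n: "?n > 0"
    using fin by (simp add: order_gt_0_iff_finite)
  have "?dim * ?n = (\<Sum>g\<in>carrier G. card (invariants ?E ?\<phi> g))"
    unfolding dim_invariants_eq_card_orbits[OF fin]
    by (rule act.burnside[OF fin finite_exponents[OF fin]])
  also have "\<dots> = (\<Sum>g\<in>carrier G. card {\<alpha> \<in> ?E. translate G g \<alpha> = \<alpha>})"
    by (intro sum.cong refl arg_cong[where f = card]) (auto simp: invariants_def)
  also have "\<dots> = (\<Sum>g\<in>carrier G. if ord g dvd m then (m div ord g + ?n div ord g - 1) choose (m div ord g) else 0)"
    using card_translate_invariants[OF fin] by (intro sum.cong refl)
  also have "\<dots> = (\<Sum>d | d dvd ?n. num_elems_ord G d * (if d dvd m then (m div d + ?n div d - 1) choose (m div d) else 0))"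
    by (rule sum_elems_by_ord[OF fin])
  also have "\<dots> = (\<Sum>d | d dvd gcd ?n m. num_elems_ord G d * ((m div d + ?n div d - 1) choose (m div d)))"
    using n by (intro sum.mono_neutral_cong_right) auto
  finally have "(?n + m) * (?dim * ?n) = (?n + m) * (\<Sum>d | d dvd gcd ?n m. num_elems_ord G d * ((m div d + ?n div d - 1) choose (m div d)))"
    by (rule arg_cong)
  then have "?n * ((?n + m) * ?dim) =
      (\<Sum>d | d dvd gcd ?n m. num_elems_ord G d * ((?n + m) * ((m div d + ?n div d - 1) choose (m div d))))"
    by (simp only: sum_distrib_left mult_ac)
  also have "\<dots> = (\<Sum>d | d dvd gcd ?n m. num_elems_ord G d * (?n * ((?n + m) div d choose (?n div d))))"
  proof (rule sum.cong[OF refl])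
    fix d assume "d \<in> {d. d dvd gcd ?n m}"
    then have "d dvd ?n" "d dvd m"
      by simp_all
    then obtain a b where a: "?n = d * a" and b: "m = d * b"
      unfolding dvd_def by blast
    have pos: "d > 0" "a > 0"
      using n a by auto
    have "(?n + m) * ((m div d + ?n div d - 1) choose (m div d)) = d * ((a + b) * (a + b - 1 choose (a - 1)))"
      using pos binomial_symmetric[of b "a + b - 1"] by (simp add: a b algebra_simps)
    also have "(a + b) * (a + b - 1 choose (a - 1)) = a * (a + b choose a)"
      using binomial_absorption[of "a - 1" "a + b"] pos by simp
    also have "d * (a * (a + b choose a)) = ?n * ((?n + m) div d choose (?n div d))"
      using pos by (simp add: a b flip: distrib_left)
    finally show "num_elems_ord G d * ((?n + m) * ((m div d + ?n div d - 1) choose (m div d))) =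
        num_elems_ord G d * (?n * ((?n + m) div d choose (?n div d)))"
      by simp
  qed
  also have "\<dots> = ?n * (\<Sum>d | d dvd gcd ?n m. num_elems_ord G d * ((?n + m) div d choose (?n div d)))"
    by (simp add: sum_distrib_left mult_ac)
  finally show ?thesis
    using n by simp
qed

end

section \<open>Comparison of the weighted sums\<close>

lemma (in group) num_elems_ord_1: "num_elems_ord G 1 = 1"
proof -
  have "{g \<in> carrier G. ord g = 1} = {\<one>}"
    using ord_eq_1 by auto
  then show ?thesis
    by (simp add: num_elems_ord_def)
qed

lemma (in group) sum_num_elems_ord:
  assumes "finite (carrier G)"
  shows "(\<Sum>d | d dvd order G. num_elems_ord G d) = order G"
  using sum_elems_by_ord[OF assms, of "\<lambda>_. 1"] by (simp add: order_def)

text \<open>The bound is strict because the identity, the only element of order 1, is left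
  out.\<close>

lemma (in group) sum_num_elems_ord_less:
  assumes fin: "finite (carrier G)" and D: "D \<subseteq> {d. d dvd order G}" "1 \<notin> D"
  shows "(\<Sum>d\<in>D. num_elems_ord G d) < order G"
proof -
  have o: "order G > 0"
    using fin by (simp add: order_gt_0_iff_finite)
  then have finD: "finite D"
    using D finite_subset by fastforce
  have "(\<Sum>d\<in>insert 1 D. num_elems_ord G d) \<le> (\<Sum>d | d dvd order G. num_elems_ord G d)"
    using D o by (intro sum_mono2) auto
  then show ?thesis
    using finD D(2) num_elems_ord_1 sum_num_elems_ord[OF fin] by simp
qed

text \<open>Frobenius' theorem, with the solutions of \<open>x [^] k = \<one>\<close> sorted by
  their order.\<close>

lemma (in group) dvd_sum_num_elems_ord:
  assumes fin: "finite (carrier G)" and k: "k dvd order G"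
  shows "k dvd (\<Sum>d | d dvd k. num_elems_ord G d)"
proof -
  have "k > 0"
    using fin k by (metis dvd_0_left_iff gr0I order_gt_0_iff_finite)
  then have finD: "finite {d. d dvd k}"
    by simp
  have "ord ` {x \<in> carrier G. x [^] k = \<one>} \<subseteq> {d. d dvd k}"
    by (auto simp: pow_eq_id)
  then have "card {x \<in> carrier G. x [^] k = \<one>} = (\<Sum>d | d dvd k. card {x \<in> {x \<in> carrier G. x [^] k = \<one>}. ord x = d})"
    using sum.group[of "{x \<in> carrier G. x [^] k = \<one>}" "{d. d dvd k}" ord "\<lambda>_. 1 :: nat"] fin finD
    by (simp del: mem_Collect_eq)
  also have "\<dots> = (\<Sum>d | d dvd k. num_elems_ord G d)"
    unfolding num_elems_ord_def by (intro sum.cong refl arg_cong[where f = card]) (auto simp: pow_eq_id)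
  finally show ?thesis
    using frobenius[OF fin k] by simp
qed

lemma (in group) prime_dvd_num_elems_ord:
  assumes fin: "finite (carrier G)" and p: "prime p" "p dvd order G"
  shows "p dvd Suc (num_elems_ord G p)"
proof -
  have "{d. d dvd p} = {1, p}"
    using p(1) by (auto simp: prime_nat_iff)
  then have "(\<Sum>d | d dvd p. num_elems_ord G d) = Suc (num_elems_ord G p)"
    using p(1) num_elems_ord_1 by (simp add: prime_nat_iff)
  then show ?thesis
    using dvd_sum_num_elems_ord[OF fin p(2)] by simp
qed

section \<open>Estimates for the binomial weights\<close>

lemma binomial_add_mono:
  assumes "a \<le> a'" "b \<le> (b' :: nat)"
  shows "(a + b) choose a \<le> (a' + b') choose a'"
proof -
  have "(a + b) choose a \<le> (a + b') choose a"
    using assms by (intro binomial_right_mono) simp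
  also have "\<dots> = (a + b') choose b'"
    using binomial_symmetric[of a "a + b'"] by simp
  also have "\<dots> \<le> (a' + b') choose b'"
    using assms by (intro binomial_right_mono) simp
  also have "\<dots> = (a' + b') choose a'"
    using binomial_symmetric[of a' "a' + b'"] by simp
  finally show ?thesis .
qed

text \<open>One step from \<open>i + 1\<close> down to \<open>i\<close> multiplies the binomial
  coefficient by \<open>(i + 1) / (i + 1 + b)\<close>. This is at most \<open>n / m\<close>, since
  \<open>m * (i + 1) <= m * a = n * b\<close>.\<close>

lemma binomial_add_ratio:
  fixes n m a b :: nat
  assumes nm: "n * b = m * a" and "j \<le> a"
  shows "m ^ j * ((a - j + b) choose (a - j)) \<le> n ^ j * ((a + b) choose a)"
  using assms(2)
proof (induction j)
  case (Suc j)
  define i where "i = a - Suc j"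
  have i: "a - j = Suc i" "Suc i \<le> a"
    using Suc.prems by (auto simp: i_def)
  have "Suc i * (m * ((i + b) choose i)) \<le> Suc i * (n * ((Suc i + b) choose Suc i))"
  proof -
    have "m * Suc i \<le> m * a"
      using i(2) by (rule mult_le_mono2)
    also have "\<dots> \<le> n * (Suc i + b)"
      using nm by (simp add: distrib_left)
    finally have "m * Suc i * ((i + b) choose i) \<le> n * (Suc i + b) * ((i + b) choose i)"
      by (rule mult_le_mono1)
    then have "Suc i * (m * ((i + b) choose i)) \<le> n * (Suc i + b) * ((i + b) choose i)"
      by (simp only: mult_ac)
    also have "n * (Suc i + b) * ((i + b) choose i) = n * (Suc i * ((Suc i + b) choose Suc i))"
    proof -
      have "(Suc i + b) * ((i + b) choose i) = Suc i * ((Suc i + b) choose Suc i)"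
        using Suc_times_binomial_eq[of "i + b" i] by (simp only: add_Suc mult.commute)
      then show ?thesis
        by (simp only: mult.assoc)
    qed
    also have "\<dots> = Suc i * (n * ((Suc i + b) choose Suc i))"
      by (rule mult.left_commute)
    finally show ?thesis .
  qed
  then have "m * ((i + b) choose i) \<le> n * ((Suc i + b) choose Suc i)"
    by (rule mult_left_le_imp_le) simp
  then have "m ^ Suc j * ((i + b) choose i) \<le> m ^ j * (n * ((Suc i + b) choose Suc i))"
    by (simp add: mult.assoc mult.left_commute)
  also have "\<dots> = n * (m ^ j * ((a - j + b) choose (a - j)))"
    using i by simp
  also have "\<dots> \<le> n * (n ^ j * ((a + b) choose a))"
    using Suc by simp
  finally show ?case
    by (simp add: i_def mult_ac)
qed simp

text \<open>With \<open>a0 = n div d0\<close> and \<open>b0 = m div d0\<close>, the weight at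
  \<open>d\<close> is at most \<open>a0 - j + b0 choose (a0 - j)\<close>, and
  \<open>n * b0 = m * a0\<close> allows \<open>j\<close> steps of the ratio estimate. For
  \<open>j = 0\<close> this is just monotonicity of the weights.\<close>

lemma binomial_ratio_divisors:
  fixes n m d d0 :: nat
  assumes n: "n > 0" and dvd: "d0 dvd n" "d0 dvd m" "d dvd n" "d dvd m"
    and le: "d0 \<le> d" and j: "n div d + j \<le> n div d0"
  shows "m ^ j * ((n + m) div d choose (n div d)) \<le> n ^ j * ((n + m) div d0 choose (n div d0))"
proof -
  define a0 b0 a b where ab: "a0 = n div d0" "b0 = m div d0" "a = n div d" "b = m div d"
  have d0: "d0 > 0"
    using n dvd by (auto intro: Nat.gr0I)
  have eq: "(n + m) div d = a + b" "(n + m) div d0 = a0 + b0"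
    using dvd by (simp_all add: ab div_add)
  have "n = d0 * a0" "m = d0 * b0"
    using dvd by (simp_all add: ab)
  then have "n * b0 = m * a0"
    by simp
  moreover have "j \<le> a0"
    using j by (simp add: ab)
  ultimately have ratio: "m ^ j * ((a0 - j + b0) choose (a0 - j)) \<le> n ^ j * ((a0 + b0) choose a0)"
    by (rule binomial_add_ratio)
  have "b \<le> b0"
    using d0 le by (simp add: ab div_le_mono2)
  then have "(a + b) choose a \<le> (a0 - j + b0) choose (a0 - j)"
    using j by (intro binomial_add_mono) (auto simp: ab)
  then have "m ^ j * ((a + b) choose a) \<le> m ^ j * ((a0 - j + b0) choose (a0 - j))"
    by (rule mult_le_mono2)
  also note ratio
  finally have "m ^ j * ((a + b) choose a) \<le> n ^ j * ((a0 + b0) choose a0)" .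
  then show ?thesis
    unfolding eq by (simp add: ab)
qed

text \<open>The term at the least index where \<open>a\<close> and \<open>b\<close> differ dominates the sum of all later terms.\<close>

lemma weighted_sum_less:
  fixes a b c :: "nat \<Rightarrow> nat"
  assumes fin: "finite D" and d0: "d0 \<in> D" and agree: "\<And>d. d \<in> D \<Longrightarrow> d < d0 \<Longrightarrow> a d = b d"
    and gap: "a d0 + q \<le> b d0"
    and dom: "\<And>d. d \<in> D \<Longrightarrow> d > d0 \<Longrightarrow> N * c d \<le> q * c d0"
    and small: "(\<Sum>d | d \<in> D \<and> d > d0. a d) < N" and pos: "q * c d0 > 0"
  shows "(\<Sum>d\<in>D. a d * c d) < (\<Sum>d\<in>D. b d * c d)"
proof -
  let ?L = "{d \<in> D. d < d0}" and ?G = "{d \<in> D. d > d0}"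
  have split: "(\<Sum>d\<in>D. f d) = (\<Sum>d\<in>?L. f d) + (f d0 + (\<Sum>d\<in>?G. f d))" for f :: "nat \<Rightarrow> nat"
  proof -
    have "D = ?L \<union> insert d0 ?G"
      using d0 by auto
    then have "(\<Sum>d\<in>D. f d) = (\<Sum>d\<in>?L \<union> insert d0 ?G. f d)"
      by simp
    also have "\<dots> = (\<Sum>d\<in>?L. f d) + (\<Sum>d\<in>insert d0 ?G. f d)"
      using fin by (intro sum.union_disjoint) auto
    finally show ?thesis
      using fin by simp
  qed
  \<comment> \<open>\<open>q\<close> is a guaranteed surplus of \<open>b\<close> at
    \<open>d0\<close>, and \<open>N\<close> exceeds the total of \<open>a\<close> above
    \<open>d0\<close>. Scaling by \<open>N\<close> avoids dividing in the comparison of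
    weights.\<close>
  have "N * (\<Sum>d\<in>?G. a d * c d) = (\<Sum>d\<in>?G. a d * (N * c d))"
    by (simp add: sum_distrib_left mult_ac)
  also have "\<dots> \<le> (\<Sum>d\<in>?G. a d * (q * c d0))"
    using dom by (intro sum_mono mult_le_mono2) auto
  also have "\<dots> = (\<Sum>d\<in>?G. a d) * (q * c d0)"
    by (simp add: sum_distrib_right)
  also have "\<dots> < N * (q * c d0)"
    using small pos by (rule mult_strict_right_mono)
  finally have "(\<Sum>d\<in>?G. a d * c d) < q * c d0"
    by simp
  then have "a d0 * c d0 + (\<Sum>d\<in>?G. a d * c d) < (a d0 + q) * c d0"
    by (simp add: distrib_right)
  also have "\<dots> \<le> b d0 * c d0"
    using gap by simp
  finally have "a d0 * c d0 + (\<Sum>d\<in>?G. a d * c d) < b d0 * c d0 + (\<Sum>d\<in>?G. b d * c d)"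
    by simp
  moreover have "(\<Sum>d\<in>?L. a d * c d) = (\<Sum>d\<in>?L. b d * c d)"
    using agree by (intro sum.cong) auto
  ultimately show ?thesis
    unfolding split[of "\<lambda>d. a d * c d"] split[of "\<lambda>d. b d * c d"] by simp
qed

text \<open>For \<open>n = 2 * p\<close> and \<open>m = 2 * p * k\<close> this compares
  \<open>m\<close> times the weight at \<open>p\<close> with the weight at 2. A common factor
  \<open>k + 1\<close> cancels. With \<open>q = p * k\<close> the remaining left side is quadratic
  in size, while \<open>p - 1 >= 4\<close> makes the right side at least
  \<open>4 + q choose 4\<close>. For \<open>p = 3\<close> and \<open>k = 1\<close> the inequality
  would read 36 <= 20.\<close>

lemma binomial_p_multiple_bound:
  fixes p k :: nat
  assumes p: "p \<ge> 5" and k: "k \<ge> 1"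
  shows "2 * p * k * ((2 + 2 * k) choose 2) \<le> (p + p * k) choose p"
proof -
  define q where "q = p * k"
  have q5: "q \<ge> 5 * k" "q \<ge> 5"
    using p k mult_le_mono[of 5 p k k] mult_le_mono[of 5 p 1 k] by (auto simp: q_def)
  have choose4: "24 * ((4 + q) choose 4) = (q + 1) * (q + 2) * (q + 3) * (q + 4)"
  proof -
    have 1: "4 * ((4 + q) choose 4) = (q + 4) * ((3 + q) choose 3)"
      using Suc_times_binomial_eq[of "3 + q" 3] by (simp add: numeral_eq_Suc)
    have 2: "3 * ((3 + q) choose 3) = (q + 3) * ((2 + q) choose 2)"
      using Suc_times_binomial_eq[of "2 + q" 2] by (simp add: numeral_eq_Suc)
    have 3: "2 * ((2 + q) choose 2) = (q + 2) * (q + 1)"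
      using Suc_times_binomial_eq[of "1 + q" 1] by (simp add: numeral_eq_Suc)
    have "24 * ((4 + q) choose 4) = 6 * (4 * ((4 + q) choose 4))"
      by simp
    also have "\<dots> = 2 * (q + 4) * (3 * ((3 + q) choose 3))"
      unfolding 1 by simp
    also have "\<dots> = (q + 4) * (q + 3) * (2 * ((2 + q) choose 2))"
      unfolding 2 by (simp add: mult_ac)
    also have "\<dots> = (q + 1) * (q + 2) * (q + 3) * (q + 4)"
      unfolding 3 by (simp only: mult_ac)
    finally show ?thesis .
  qed
  \<comment> \<open>The factor 24 clears the denominator of the binomial coefficient, and 5 comes
    from \<open>5 * (2 * k + 1) <= 15 * k <= 3 * q\<close>. From \<open>q >= 5\<close> each of the
    two paired quadratic factors is at least \<open>10 * q\<close>.\<close>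
  have "2 * q * (2 * k + 1) \<le> (4 + q) choose 4"
  proof -
    have "5 * (2 * k + 1) \<le> 3 * q"
      using q5 k by simp
    then have "48 * q * (5 * (2 * k + 1)) \<le> 48 * q * (3 * q)"
      by (rule mult_le_mono2)
    also have "\<dots> \<le> 5 * ((10 * q) * (10 * q))"
      by simp
    also have "\<dots> \<le> 5 * (((q + 1) * (q + 4)) * ((q + 2) * (q + 3)))"
    proof -
      have "5 * q \<le> q * q"
        using q5(2) by (rule mult_le_mono1)
      then have "10 * q \<le> (q + 1) * (q + 4)" "10 * q \<le> (q + 2) * (q + 3)"
        unfolding distrib_left distrib_right by linarith+
      then show ?thesis
        by (rule mult_le_mono2[OF mult_le_mono])
    qed
    also have "\<dots> = 5 * (24 * ((4 + q) choose 4))"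
      unfolding choose4 by (simp only: mult_ac)
    finally show ?thesis
      unfolding distrib_left distrib_right by linarith
  qed
  also have "(4 + q) choose 4 \<le> (p - 1 + q) choose (p - 1)"
    using p by (intro binomial_add_mono) auto
  finally have le: "2 * q * (2 * k + 1) \<le> (p - 1 + q) choose (p - 1)" .
  have "p * ((p + q) choose p) = (p + q) * ((p - 1 + q) choose (p - 1))"
    using Suc_times_binomial_eq[of "p - 1 + q" "p - 1"] p by (simp add: mult.commute)
  also have "\<dots> = p * ((k + 1) * ((p - 1 + q) choose (p - 1)))"
    by (simp add: q_def algebra_simps)
  finally have eq: "(p + q) choose p = (k + 1) * ((p - 1 + q) choose (p - 1))"
    using p by simp
  have "(2 + 2 * k) choose 2 = (k + 1) * (2 * k + 1)"
    by (simp add: choose_two)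
  then have "2 * p * k * ((2 + 2 * k) choose 2) = (k + 1) * (2 * q * (2 * k + 1))"
    by (simp only: q_def mult_ac)
  also have "\<dots> \<le> (k + 1) * ((p - 1 + q) choose (p - 1))"
    using le by (rule mult_le_mono2)
  finally show ?thesis
    unfolding eq[symmetric] by (simp add: q_def)
qed

section \<open>Element orders in dihedral groups\<close>

lemma dihedral_group_no_elem_of_full_order:
  fixes G (structure)
  assumes dih: "dihedral_group p G" and p: "prime p" "p \<ge> 3" and fin: "finite (carrier G)"
  shows "num_elems_ord G (2 * p) = 0"
proof -
  interpret group G
    using dih by (simp add: dihedral_group_def)
  obtain x y where xy: "x \<in> carrier G" "y \<in> carrier G" "generate G {x, y} = carrier G"
    "x [^] (2::nat) = \<one>" "y [^] p = \<one>" "x \<otimes> y \<otimes> x = inv y" and oG: "order G = 2 * p"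
    using dih by (auto simp: dihedral_group_def)
  \<comment> \<open>Such a \<open>g\<close> would make the group cyclic, so \<open>x\<close> and
    \<open>y\<close> would commute and the relation would give
    \<open>y \<otimes> y = \<one>\<close>. As \<open>p\<close> is odd, \<open>y\<close> would be
    trivial, leaving a group generated by \<open>x\<close>, of order at most 2.\<close>
  have "ord g \<noteq> 2 * p" if g: "g \<in> carrier G" for g
  proof
    assume "ord g = 2 * p"
    then have "generate G {g} = carrier G"
      using generate_pow_card[OF g] oG fin generate_incl[of "{g}"] g
      by (intro card_subset_eq) (auto simp: order_def)
    then obtain i j :: nat where "x = g [^] i" "y = g [^] j"
      using generate_pow_on_finite_carrier[OF fin g] xy by blast
    then have "x \<otimes> y = y \<otimes> x"
      using g by (simp add: nat_pow_mult add.commute)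
    then have "inv y = y \<otimes> (x \<otimes> x)"
      using xy by (metis m_assoc)
    also have "x \<otimes> x = \<one>"
      using xy by (simp add: numeral_2_eq_2)
    finally have "y \<otimes> y = \<one>"
      using xy by (metis r_inv r_one)
    then have "ord y dvd 2"
      using xy by (simp add: numeral_2_eq_2 flip: pow_eq_id)
    moreover have "ord y dvd p"
      using xy by (simp flip: pow_eq_id)
    moreover have "coprime 2 p"
      using p by (simp add: prime_odd_nat)
    ultimately have "ord y = 1"
      using coprime_common_divisor_nat by blast
    then have "y = \<one>"
      using ord_eq_1[OF xy(2)] by simp
    then have "{x, y} \<subseteq> generate G {x}"
      using generate.one[of G "{x}"] generate.incl[of x "{x}" G] by simp
    then have "carrier G \<subseteq> generate G {x}"
      using generate_subgroup_incl[of "{x, y}" "generate G {x}"] generate_is_subgroup[of "{x}"]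
      unfolding xy(3) using xy(1) by simp
    moreover have "finite (generate G {x})"
      using fin generate_incl[of "{x}"] xy(1) finite_subset by blast
    ultimately have "order G \<le> ord x"
      using generate_pow_card[OF xy(1)] card_mono by (simp add: order_def)
    moreover have "ord x dvd 2"
      using xy by (simp flip: pow_eq_id)
    then have "ord x \<le> 2"
      by (simp add: dvd_imp_le)
    ultimately show False
      using oG p by simp
  qed
  then have "{g \<in> carrier G. ord g = 2 * p} = {}"
    by auto
  then show ?thesis
    by (simp only: num_elems_ord_def card.empty)
qed

text \<open>Frobenius' theorem makes \<open>Suc (num_elems_ord G p)\<close> a positive multiple of
  \<open>p\<close>. There is also an element of order 2, as their number is odd, so together with
  the identity too little room is left for \<open>2 * p\<close>.\<close>

lemma dihedral_group_num_elems_ord_prime: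
  assumes dih: "dihedral_group p G" and p: "prime p" "p \<ge> 3" and fin: "finite (carrier G)"
  shows "Suc (num_elems_ord G p) = p"
proof -
  interpret group G
    using dih by (simp add: dihedral_group_def)
  have oG: "order G = 2 * p"
    using dih by (simp add: dihedral_group_def)
  have "2 dvd Suc (num_elems_ord G 2)"
    using prime_dvd_num_elems_ord[OF fin two_is_prime_nat] oG by simp
  then have "num_elems_ord G 2 > 0"
    by (auto intro: Nat.gr0I)
  moreover have "(\<Sum>d\<in>{2, p}. num_elems_ord G d) < order G"
    using oG p by (intro sum_num_elems_ord_less[OF fin]) (auto simp: prime_nat_iff)
  ultimately have "Suc (num_elems_ord G p) < 2 * p"
    using p oG by simp
  moreover obtain k where k: "Suc (num_elems_ord G p) = p * k"
    using prime_dvd_num_elems_ord[OF fin p(1)] oG by auto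
  ultimately have "k < 2"
    by (simp add: mult.commute)
  moreover have "k \<noteq> 0"
    using k by (cases k) auto
  ultimately have "k = 1"
    by simp
  then show ?thesis
    using k by simp
qed

text \<open>In both groups the counts over all divisors of \<open>k\<close> add up to a multiple of
  \<open>k\<close>. The proper divisors contribute equally, so the counts at \<open>k\<close> differ
  by a multiple of \<open>k\<close>.\<close>

lemma frobenius_gap:
  fixes G :: "('g, 'y) monoid_scheme" and H :: "('h, 'z) monoid_scheme"
  assumes G: "group G" "finite (carrier G)" and H: "group H" "finite (carrier H)"
    and k: "k dvd order G" "k dvd order H"
    and agree: "\<And>d. d dvd k \<Longrightarrow> d < k \<Longrightarrow> num_elems_ord G d = num_elems_ord H d"
    and less: "num_elems_ord H k < num_elems_ord G k"
  shows "num_elems_ord H k + k \<le> num_elems_ord G k"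
proof -
  have "order G > 0"
    using G by (simp add: group.is_monoid monoid.order_gt_0_iff_finite)
  then have kpos: "k > 0"
    using k by (auto intro: Nat.gr0I)
  let ?P = "{d. d dvd k \<and> d < k}"
  have D: "{d. d dvd k} = insert k ?P"
    using kpos by (auto dest: dvd_imp_le)
  have eq: "(\<Sum>d | d dvd k. f d) = f k + sum f ?P" for f :: "nat \<Rightarrow> nat"
    unfolding D by simp
  have "k dvd num_elems_ord G k + (\<Sum>d\<in>?P. num_elems_ord G d)"
    "k dvd num_elems_ord H k + (\<Sum>d\<in>?P. num_elems_ord H d)"
    using group.dvd_sum_num_elems_ord[OF G k(1)] group.dvd_sum_num_elems_ord[OF H k(2)]
    unfolding eq .
  moreover have "(\<Sum>d\<in>?P. num_elems_ord G d) = (\<Sum>d\<in>?P. num_elems_ord H d)"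
    using agree by (intro sum.cong) auto
  ultimately have "k dvd (num_elems_ord G k + (\<Sum>d\<in>?P. num_elems_ord G d)) - (num_elems_ord H k + (\<Sum>d\<in>?P. num_elems_ord G d))"
    by (intro dvd_diff_nat) simp_all
  then have "k dvd num_elems_ord G k - num_elems_ord H k"
    by simp
  then show ?thesis
    using less dvd_imp_le[of k "num_elems_ord G k - num_elems_ord H k"] by simp
qed

lemma dims_eq_iff_weighted_sums_eq:
  fixes G :: "('g, 'y) monoid_scheme" and H :: "('h, 'z) monoid_scheme"
  assumes G: "group G" "finite (carrier G)" and H: "group H" "finite (carrier H)"
  shows "cfun.dim (invariant_poly_funs_deg G (regular_space G) (regular_rep G) (order H)) =
      cfun.dim (invariant_poly_funs_deg H (regular_space H) (regular_rep H) (order G)) \<longleftrightarrow>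
    (\<Sum>d | d dvd gcd (order G) (order H). num_elems_ord G d * ((order G + order H) div d choose (order G div d))) =
    (\<Sum>d | d dvd gcd (order G) (order H). num_elems_ord H d * ((order G + order H) div d choose (order G div d)))"
    (is "?dG = ?dH \<longleftrightarrow> ?SG = ?SH")
proof -
  let ?n = "order G" and ?m = "order H"
  have "?n > 0"
    using G by (simp add: group.is_monoid monoid.order_gt_0_iff_finite)
  have dG: "(?n + ?m) * ?dG = ?SG"
    by (rule group.dim_invariants_formula[OF G])
  have dH: "(?n + ?m) * ?dH = ?SH"
  proof -
    have "(?m + ?n) * ?dH = (\<Sum>d | d dvd gcd ?m ?n. num_elems_ord H d * ((?m + ?n) div d choose (?m div d)))"
      by (rule group.dim_invariants_formula[OF H])
    also have "\<dots> = ?SH"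
    proof (rule sum.cong)
      show "{d. d dvd gcd ?m ?n} = {d. d dvd gcd ?n ?m}"
        by (simp add: gcd.commute)
      fix d assume "d \<in> {d. d dvd gcd ?n ?m}"
      then have "(?n + ?m) div d = ?n div d + ?m div d"
        by (simp add: div_add)
      then show "num_elems_ord H d * ((?m + ?n) div d choose (?m div d)) =
          num_elems_ord H d * ((?n + ?m) div d choose (?n div d))"
        using binomial_symmetric[of "?n div d" "?n div d + ?m div d"] by (simp add: add.commute)
    qed
    finally show ?thesis
      by (simp add: add.commute)
  qed
  have "?dG = ?dH \<longleftrightarrow> (?n + ?m) * ?dG = (?n + ?m) * ?dH"
    using \<open>?n > 0\<close> by simp
  then show ?thesis
    unfolding dG dH .
qed

text \<open>The quotients \<open>n div d0\<close> and \<open>n div d\<close> are themselves divisors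
  of \<open>n\<close>. If they are consecutive, the hypothesis excludes all cases except the
  quotients 2 and 1, because it speaks of divisors above 1 only.\<close>

lemma no_consecutive_divisors_quotients:
  fixes n d d0 :: nat
  assumes n: "n > 0" and dvd: "d0 dvd n" "d dvd n" and less: "d0 < d"
    and nocons: "\<not> (\<exists>d1 d2 :: nat. d1 > 1 \<and> d2 > 1 \<and> d1 dvd n \<and> d2 dvd n \<and> d1 - d2 = 1)"
  shows "n div d + 2 \<le> n div d0 \<or> (d = n \<and> n = 2 * d0)"
proof -
  obtain a0 a where a0: "n = d0 * a0" and a: "n = d * a"
    using dvd unfolding dvd_def by blast
  have pos: "d0 > 0" "d > 0" "a0 > 0" "a > 0"
    using n a0 a by (auto intro: Nat.gr0I)
  have quot: "n div d0 = a0" "n div d = a"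
    using pos by (simp add: a0, simp add: a)
  have "a < a0"
  proof (rule ccontr)
    assume "\<not> a < a0"
    then have "d0 * a0 < d * a"
      using less pos by (intro mult_less_le_imp_less) auto
    then show False
      using a0 a by simp
  qed
  show ?thesis
  proof (cases "a0 = Suc a")
    case True
    have "a0 dvd n" "a dvd n"
      by (simp add: a0, simp add: a)
    moreover have "a0 - a = 1"
      using True by simp
    ultimately have "\<not> a > 1"
      using nocons \<open>a < a0\<close> by (meson less_trans)
    then have "a = 1"
      using pos by simp
    then show ?thesis
      using True a0 a by simp
  qed (use \<open>a < a0\<close> quot in simp)
qed

section \<open>The two cases of the hypothesis\<close>

lemma least_difference:
  fixes a b :: "nat \<Rightarrow> nat"
  assumes "d \<in> D" "a d \<noteq> b d"
  obtains d0 where "d0 \<in> D" "a d0 \<noteq> b d0" "\<And>e. e \<in> D \<Longrightarrow> e < d0 \<Longrightarrow> a e = b e"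
  using exists_least_iff[of "\<lambda>d. d \<in> D \<and> a d \<noteq> b d"] assms by metis

text \<open>The domination lemma is applied with surplus \<open>q\<close> and mass \<open>N\<close>
  equal to 1 and \<open>n\<close> if H is ahead at \<open>d0\<close>, to 1 and \<open>m\<close> if G
  is ahead, and to \<open>d0\<close> and \<open>m\<close> in the exceptional case
  \<open>n = 2 * d0\<close> with \<open>n dvd m\<close>.\<close>

lemma num_elems_ord_eq_of_sums_eq:
  fixes G :: "('g, 'y) monoid_scheme" and H :: "('h, 'z) monoid_scheme"
  assumes G: "group G" "finite (carrier G)" and H: "group H" "finite (carrier H)"
  defines "n \<equiv> order G" and "m \<equiv> order H"
  defines "c \<equiv> (\<lambda>d. (n + m) div d choose (n div d))"
  assumes mn: "n\<^sup>2 \<le> m"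
    and nocons: "\<not> (\<exists>d1 d2 :: nat. d1 > 1 \<and> d2 > 1 \<and> d1 dvd n \<and> d2 dvd n \<and> d1 - d2 = 1)"
    and sums: "(\<Sum>d | d dvd gcd n m. num_elems_ord G d * c d) = (\<Sum>d | d dvd gcd n m. num_elems_ord H d * c d)"
    and d: "d dvd gcd n m"
  shows "num_elems_ord G d = num_elems_ord H d"
proof (rule ccontr)
  assume "num_elems_ord G d \<noteq> num_elems_ord H d"
  let ?D = "{d. d dvd gcd n m}"
  obtain d0 where d0D: "d0 \<in> ?D" and ne: "num_elems_ord G d0 \<noteq> num_elems_ord H d0"
    and agree: "\<And>e. e \<in> ?D \<Longrightarrow> e < d0 \<Longrightarrow> num_elems_ord G e = num_elems_ord H e"
    using d \<open>num_elems_ord G d \<noteq> num_elems_ord H d\<close>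
    by (elim least_difference[of d ?D "num_elems_ord G" "num_elems_ord H", rotated 2]) simp_all
  from d0D have d0: "d0 dvd n" "d0 dvd m"
    by simp_all
  have n: "n > 0" and m: "m > 0"
    using G H by (simp_all add: n_def m_def group.is_monoid monoid.order_gt_0_iff_finite)
  have finD: "finite ?D"
    using n by simp
  have "d0 > 0"
    using d0 n by (auto intro: Nat.gr0I)
  moreover have "d0 \<noteq> 1"
    using ne group.num_elems_ord_1[OF G(1)] group.num_elems_ord_1[OF H(1)] by metis
  ultimately have d01: "d0 > 1"
    by simp
  have cpos: "c e > 0" if "e \<in> ?D" for e
    using that by (auto simp: c_def intro!: zero_less_binomial div_le_mono)
  have small: "(\<Sum>e | e \<in> ?D \<and> e > d0. num_elems_ord G e) < n"
    "(\<Sum>e | e \<in> ?D \<and> e > d0. num_elems_ord H e) < m"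
    using d01 unfolding n_def m_def
    by (auto intro!: group.sum_num_elems_ord_less G H)
  have ratio: "m ^ j * c e \<le> n ^ j * c d0" if "e \<in> ?D" "e > d0" "n div e + j \<le> n div d0" for e j
    unfolding c_def using that d0 n by (intro binomial_ratio_divisors) auto
  have dichotomy: "n div e + 2 \<le> n div d0 \<or> (e = n \<and> n = 2 * d0)" if "e \<in> ?D" "e > d0" for e
    using no_consecutive_divisors_quotients[OF n d0(1) _ _ nocons] that by simp
  have dom2: "m * c e \<le> c d0" if "e \<in> ?D" "e > d0" "n div e + 2 \<le> n div d0" for e
  proof -
    have "m * (m * c e) = m ^ 2 * c e"
      by (simp add: power2_eq_square)
    also have "\<dots> \<le> n ^ 2 * c d0"
      using ratio that by blast
    also have "\<dots> \<le> m * c d0"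
      using mn by (rule mult_le_mono1)
    finally show ?thesis
      using m by simp
  qed
  have dom1: "n * c e \<le> c d0" if e: "e \<in> ?D" "e > d0" for e
  proof -
    have "n div e + 1 \<le> n div d0"
      using dichotomy[OF e] n \<open>d0 > 0\<close> by auto
    then have "m * c e \<le> n * c d0"
      using ratio[of e 1] e by simp
    moreover have "n * n * c e \<le> m * c e"
      using mn by (intro mult_le_mono1) (simp add: power2_eq_square)
    ultimately have "n * n * c e \<le> n * c d0"
      by linarith
    then have "n * (n * c e) \<le> n * c d0"
      by (simp only: mult.assoc)
    then show ?thesis
      using n by simp
  qed
  show False
  proof (cases "num_elems_ord G d0 < num_elems_ord H d0")
    case True
    have "(\<Sum>d\<in>?D. num_elems_ord G d * c d) < (\<Sum>d\<in>?D. num_elems_ord H d * c d)"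
      by (rule weighted_sum_less[OF finD d0D, where q = 1 and N = n])
        (use agree True dom1 small cpos d0D in auto)
    then show False
      using sums by simp
  next
    case False
    then have less: "num_elems_ord H d0 < num_elems_ord G d0"
      using ne by simp
    have "(\<Sum>d\<in>?D. num_elems_ord H d * c d) < (\<Sum>d\<in>?D. num_elems_ord G d * c d)"
    proof (cases "n = 2 * d0 \<and> n dvd m")
      case True
      then obtain t where t: "m = n * t"
        by (auto elim: dvdE)
      have agree': "num_elems_ord G e = num_elems_ord H e" if "e dvd d0" "e < d0" for e
        using agree[of e] that d0 by (auto intro: dvd_trans)
      have gap: "num_elems_ord H d0 + d0 \<le> num_elems_ord G d0"
        using frobenius_gap[OF G H] d0 agree' less unfolding n_def m_def by blast
      have "m * c e \<le> d0 * c d0" if e: "e \<in> ?D" "e > d0" for e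
      proof -
        \<comment> \<open>Here \<open>n div d0 = 2\<close>, so a drop by two would need
          \<open>n div e = 0\<close>; only \<open>e = n\<close> is left.\<close>
        have "n div e \<noteq> 0"
          using e n by (simp add: dvd_div_eq_0_iff)
        then have "e = n"
          using dichotomy[OF e] True \<open>d0 > 0\<close> by auto
        have "(n + m) div n = 1 + t" "(n + m) div d0 = 2 + 2 * t"
          using t True n \<open>d0 > 0\<close> by (auto simp: div_add)
        then have cn: "c n = 1 + t" and cd0: "c d0 = (1 + t) * (1 + 2 * t)"
          using n True \<open>d0 > 0\<close> by (auto simp: c_def choose_two)
        \<comment> \<open>The weight at \<open>d0\<close> is \<open>1 + 2 * t\<close> times the
          weight at \<open>n\<close>, while \<open>m = 2 * d0 * t\<close>. So the surplus
          \<open>d0\<close> from \<open>frobenius_gap\<close> is just large enough.\<close>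
        have "m \<le> d0 * (1 + 2 * t)"
          using t True by (simp add: algebra_simps)
        then have "m * (1 + t) \<le> d0 * (1 + 2 * t) * (1 + t)"
          by (rule mult_le_mono1)
        then show ?thesis
          unfolding \<open>e = n\<close> cn cd0 by (simp only: mult_ac)
      qed
      then show ?thesis
        by (intro weighted_sum_less[OF finD d0D, where q = d0 and N = m])
          (use agree gap small cpos d0D \<open>d0 > 0\<close> in auto)
    next
      case False
      \<comment> \<open>The exceptional alternative \<open>e = n = 2 * d0\<close> would make
        \<open>n\<close> a divisor of \<open>m\<close>, since \<open>e\<close> is a common
        divisor.\<close>
      have "m * c e \<le> c d0" if e: "e \<in> ?D" "e > d0" for e
        using dom2[OF e] dichotomy[OF e] e False by auto
      then show ?thesis
        by (intro weighted_sum_less[OF finD d0D, where q = 1 and N = m])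
          (use agree less small cpos d0D in auto)
    qed
    then show False
      using sums by simp
  qed
qed

text \<open>Without \<open>n^2 <= m\<close> the general ratio estimate is too weak, so the few
  possible divisors are treated by hand. Strong domination is needed only for \<open>d0 = 2\<close>
  with \<open>2 * p dvd m\<close>. Otherwise no common divisor above \<open>d0\<close> remains, or
  only \<open>2 * p\<close>, an order that G does not realize; and at \<open>p\<close> and
  \<open>2 * p\<close> G cannot be ahead.\<close>

lemma dihedral_num_elems_ord_eq_of_sums_eq:
  fixes G :: "('g, 'y) monoid_scheme" and H :: "('h, 'z) monoid_scheme"
  assumes G: "group G" "finite (carrier G)" and H: "group H" "finite (carrier H)"
    and p: "prime p" "p \<ge> 5" and dih: "dihedral_group p G"
  defines "n \<equiv> order G" and "m \<equiv> order H"
  defines "c \<equiv> (\<lambda>d. (n + m) div d choose (n div d))"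
  assumes sums: "(\<Sum>d | d dvd gcd n m. num_elems_ord G d * c d) = (\<Sum>d | d dvd gcd n m. num_elems_ord H d * c d)"
    and d: "d dvd gcd n m"
  shows "num_elems_ord G d = num_elems_ord H d"
proof (rule ccontr)
  assume "num_elems_ord G d \<noteq> num_elems_ord H d"
  let ?D = "{d. d dvd gcd n m}"
  obtain d0 where d0D: "d0 \<in> ?D" and ne: "num_elems_ord G d0 \<noteq> num_elems_ord H d0"
    and agree: "\<And>e. e \<in> ?D \<Longrightarrow> e < d0 \<Longrightarrow> num_elems_ord G e = num_elems_ord H e"
    using d \<open>num_elems_ord G d \<noteq> num_elems_ord H d\<close>
    by (elim least_difference[of d ?D "num_elems_ord G" "num_elems_ord H", rotated 2]) simp_all
  from d0D have d0: "d0 dvd n" "d0 dvd m"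
    by simp_all
  have m: "m > 0"
    using H by (simp add: m_def group.is_monoid monoid.order_gt_0_iff_finite)
  have n: "n = 2 * p"
    using dih by (simp add: n_def dihedral_group_def)
  have finD: "finite ?D"
    using m by simp
  have d01: "d0 \<noteq> 1"
    using ne group.num_elems_ord_1[OF G(1)] group.num_elems_ord_1[OF H(1)] by metis
  have divisors: "e = 1 \<or> e = 2 \<or> e = p \<or> e = 2 * p" if "e \<in> ?D" for e
  proof -
    obtain a b where ab: "e = a * b" "a dvd 2" "b dvd p"
      using \<open>e \<in> ?D\<close> n division_decomp[of e 2 p] by auto
    have "a = 1 \<or> a = 2" "b = 1 \<or> b = p"
      using ab p(1) two_is_prime_nat unfolding prime_nat_iff by blast+
    then show ?thesis
      using ab(1) by auto
  qed
  have cpos: "c e > 0" if "e \<in> ?D" for e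
    using that by (auto simp: c_def intro!: zero_less_binomial div_le_mono)
  have small: "(\<Sum>e | e \<in> ?D \<and> e > d0. num_elems_ord G e) < n"
    "(\<Sum>e | e \<in> ?D \<and> e > d0. num_elems_ord H e) < m"
  proof -
    have "d0 > 0"
      using d0 m by (auto intro: Nat.gr0I)
    then show "(\<Sum>e | e \<in> ?D \<and> e > d0. num_elems_ord G e) < n"
      "(\<Sum>e | e \<in> ?D \<and> e > d0. num_elems_ord H e) < m"
      unfolding n_def m_def by (auto intro!: group.sum_num_elems_ord_less G H)
  qed
  have phi_p: "num_elems_ord G p \<le> num_elems_ord H p" if "p dvd m"
  proof -
    have "p dvd Suc (num_elems_ord H p)"
      using group.prime_dvd_num_elems_ord[OF H p(1)] that by (simp add: m_def)
    then have "p \<le> Suc (num_elems_ord H p)"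
      by (rule dvd_imp_le) simp
    then show ?thesis
      using dihedral_group_num_elems_ord_prime[OF dih p(1) _ G(2)] p(2) by simp
  qed
  have phi_2p: "num_elems_ord G (2 * p) = 0"
    using dihedral_group_no_elem_of_full_order[OF dih p(1) _ G(2)] p(2) by simp
  \<comment> \<open>Every \<open>e\<close> above 2 is at least \<open>p\<close>, so it is enough to
    bound the weight at \<open>p\<close>; and \<open>n <= m\<close> because \<open>2 * p\<close>
    divides \<open>m\<close>.\<close>
  have dom: "n * c e \<le> c d0" "m * c e \<le> c d0" if e: "e \<in> ?D" "e > d0" and d02: "d0 = 2" and "2 * p dvd m" for e
  proof -
    obtain k where k: "m = 2 * p * k"
      using \<open>2 * p dvd m\<close> by (elim dvdE)
    have k1: "k \<ge> 1"
      using m k by (cases k) auto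
    have p0: "p > 0"
      using p by simp
    have "(n + m) div 2 = p + p * k" "n div 2 = p"
      using n k by auto
    then have c2: "c 2 = (p + p * k) choose p"
      by (simp add: c_def)
    have "n + m = p * (2 + 2 * k)"
      using n k by (simp add: algebra_simps)
    then have "(n + m) div p = 2 + 2 * k" "n div p = 2"
      using n p0 by auto
    then have cp: "c p = (2 + 2 * k) choose 2"
      by (simp add: c_def)
    have "p \<le> e"
      using divisors[OF e(1)] e(2) d02 by auto
    then have "n div e + 0 \<le> n div p"
      using p0 by (simp add: div_le_mono2)
    then have "m ^ 0 * c e \<le> n ^ 0 * c p"
      unfolding c_def using e(1) n k p0 \<open>p \<le> e\<close> by (intro binomial_ratio_divisors) auto
    then have "m * c e \<le> m * c p"
      by simp
    also have "\<dots> \<le> c 2"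
      using binomial_p_multiple_bound[OF p(2) k1] by (simp add: c2 cp k)
    finally show "m * c e \<le> c d0"
      by (simp add: d02)
    moreover have "n * c e \<le> m * c e"
      using n k k1 by simp
    ultimately show "n * c e \<le> c d0"
      by linarith
  qed
  have mono: "1 * c e \<le> 1 * c d0" if "e \<in> ?D" "e > d0" for e
  proof -
    have "d0 > 0"
      using d0 m by (auto intro: Nat.gr0I)
    then have "n div e + 0 \<le> n div d0"
      using that by (simp add: div_le_mono2)
    then have "m ^ 0 * c e \<le> n ^ 0 * c d0"
      unfolding c_def using that d0 n p by (intro binomial_ratio_divisors) auto
    then show ?thesis
      by simp
  qed
  have d0_cases: "d0 = 2 \<or> d0 = p \<or> d0 = 2 * p"
    using divisors[OF d0D] d01 by simp
  have no_above: "\<not> (e \<in> ?D \<and> e > d0)" if "d0 = 2" "\<not> 2 * p dvd m" for e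
  proof
    assume e: "e \<in> ?D \<and> e > d0"
    then have "p dvd m"
      using divisors[of e] that by auto
    moreover have "2 dvd m"
      using d0 that by simp
    moreover have "coprime 2 p"
      using p by (simp add: prime_odd_nat)
    ultimately show False
      using that divides_mult by blast
  qed
  show False
  proof (cases "num_elems_ord G d0 < num_elems_ord H d0")
    case True
    have "(\<Sum>d\<in>?D. num_elems_ord G d * c d) < (\<Sum>d\<in>?D. num_elems_ord H d * c d)"
    proof (cases "d0 = 2 \<and> 2 * p dvd m")
      case d02: True
      show ?thesis
        by (rule weighted_sum_less[OF finD d0D, where q = 1 and N = n])
          (use agree True dom d02 small cpos d0D in auto)
    next
      case False
      have "num_elems_ord G e = 0" if e: "e \<in> ?D" "e > d0" for e
      proof -
        have "e = 2 * p"
          using divisors[OF e(1)] d0_cases no_above[of e] False e p by auto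
        then show ?thesis
          using phi_2p by simp
      qed
      \<comment> \<open>With no elements of G above \<open>d0\<close>, the mass bound is
        \<open>N = 1\<close>, and monotonicity of the weights is domination enough.\<close>
      then have "(\<Sum>e | e \<in> ?D \<and> e > d0. num_elems_ord G e) < 1"
        by simp
      then show ?thesis
        by (intro weighted_sum_less[OF finD d0D, where q = 1 and N = 1])
          (use agree True mono cpos d0D in auto)
    qed
    then show False
      using sums by simp
  next
    case False
    then have less: "num_elems_ord H d0 < num_elems_ord G d0"
      using ne by simp
    then have d02: "d0 = 2"
      using d0_cases phi_p phi_2p d0 by auto
    have "(\<Sum>d\<in>?D. num_elems_ord H d * c d) < (\<Sum>d\<in>?D. num_elems_ord G d * c d)"
    proof (cases "2 * p dvd m")
      case True
      show ?thesis
        by (rule weighted_sum_less[OF finD d0D, where q = 1 and N = m])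
          (use agree less dom d02 True small cpos d0D in auto)
    next
      case False
      then have "{e. e \<in> ?D \<and> e > d0} = {}"
        using no_above d02 by blast
      then have "(\<Sum>e | e \<in> ?D \<and> e > d0. num_elems_ord H e) < 1"
        by (simp only: sum.empty)
      then show ?thesis
        by (intro weighted_sum_less[OF finD d0D, where q = 1 and N = 1])
          (use agree less mono cpos d0D in auto)
    qed
    then show False
      using sums by simp
  qed
qed

theorem theorem1p3:
  fixes G :: "('g, 'y) monoid_scheme" and H :: "('h, 'z) monoid_scheme"
  assumes "group G" and "finite (carrier G)"
    and "group H" and "finite (carrier H)"
    and "(\<exists>p::nat. prime p \<and> p \<ge> 5 \<and> dihedral_group p G) \<or>
         (order H \<ge> (order G)\<^sup>2 \<and>
          \<not> (\<exists>d1 d2 :: nat. d1 > 1 \<and> d2 > 1 \<and> d1 dvd order G \<and> d2 dvd order G \<and> d1 - d2 = 1))"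
  shows "cfun.dim (invariant_poly_funs_deg G (regular_space G) (regular_rep G) (order H)) =
         cfun.dim (invariant_poly_funs_deg H (regular_space H) (regular_rep H) (order G)) \<longleftrightarrow>
         (\<forall>d::nat. d > 0 \<longrightarrow> d dvd gcd (order G) (order H) \<longrightarrow>
            num_elems_ord G d = num_elems_ord H d)"
proof -
  note G = assms(1,2) and H = assms(3,4)
  have "order G > 0"
    using G by (simp add: group.is_monoid monoid.order_gt_0_iff_finite)
  then have pos: "d > 0" if "d dvd gcd (order G) (order H)" for d
    using that by (auto intro: Nat.gr0I)
  show ?thesis
    unfolding dims_eq_iff_weighted_sums_eq[OF G H]
  proof
    assume sums: "(\<Sum>d | d dvd gcd (order G) (order H). num_elems_ord G d * ((order G + order H) div d choose (order G div d))) =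
      (\<Sum>d | d dvd gcd (order G) (order H). num_elems_ord H d * ((order G + order H) div d choose (order G div d)))"
    show "\<forall>d::nat. d > 0 \<longrightarrow> d dvd gcd (order G) (order H) \<longrightarrow> num_elems_ord G d = num_elems_ord H d"
      using assms(5)
    proof (elim disjE exE conjE)
      fix p assume "prime p" "p \<ge> 5" "dihedral_group p G"
      then show ?thesis
        using dihedral_num_elems_ord_eq_of_sums_eq[OF G H _ _ _ sums] by blast
    next
      assume "order H \<ge> (order G)\<^sup>2"
        "\<not> (\<exists>d1 d2 :: nat. d1 > 1 \<and> d2 > 1 \<and> d1 dvd order G \<and> d2 dvd order G \<and> d1 - d2 = 1)"
      then show ?thesis
        using num_elems_ord_eq_of_sums_eq[OF G H _ _ sums] by blast
    qed
  next
    assume "\<forall>d::nat. d > 0 \<longrightarrow> d dvd gcd (order G) (order H) \<longrightarrow> num_elems_ord G d = num_elems_ord H d"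
    then show "(\<Sum>d | d dvd gcd (order G) (order H). num_elems_ord G d * ((order G + order H) div d choose (order G div d))) =
      (\<Sum>d | d dvd gcd (order G) (order H). num_elems_ord H d * ((order G + order H) div d choose (order G div d)))"
      using pos by (intro sum.cong) auto
  qed
qed

end
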